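(* There exists an algorithm which, given a finite alphabet $X$ with at least two letters, a bounded automaton $A$ over $X$ and an eventually periodic sequence $w\in X^{\omega}$ (given as $w=uvvv\ldots$ by finite words $u,v\in X^*$, $v$ nonempty), decides whether the $G_A$-orbit of $w$ is finite.
   Context: A finite automaton over a finite alphabet $X$ ($|X|\ge 2$) is a tuple $A=(S,X,\pi)$ with $S$ a finite set of states and $\pi:S\times X\to X\times S$; write $s\xrightarrow{x|y}t$ when $\pi(s,x)=(y,t)$. Each state $s$ defines a length-preserving transformation of $X^*$: $s(x_1\ldots x_n)=y_1\ldots y_n$ if there is a path $s=s_1\xrightarrow{x_1|y_1}s_2\xrightarrow{x_2|y_2}\cdots\xrightarrow{x_n|y_n}s_{n+1}$; the final state $s_{n+1}$ is the section $s|_v$ of $s$ at $v=x_1\ldots x_n$. This action extends naturally to the space $X^\omega$ of right-infinite words. All automata are assumed minimal, i.e. different states define different transformations, and states are identified with the transformations they define; $e$ denotes the identity transformation (the trivial state). $A$ is invertible if every state defines an invertible transformation; then the automaton group $G_A$ is the group generated under composition by the transformations defined by the states of $A$; it acts on $X^*$ and on $X^\omega$. An invertible finite automaton $A$ is bounded if there is a constant $C$ such that $|\{v\in X^n : s|_v\neq e\}|\le C$ for all $n\in\mathbb{N}$ and all states $s$ of $A$. *)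

theory Defs
  imports
    "HOL-Algebra.Bij"
    "HOL-Algebra.Generated_Groups"
    "HOL-Algebra.Group_Action"
    "HOL-Library.Nat_Bijection"
    "HOL-Library.Omega_Words_Fun"
begin

text \<open>
  \<open>trans A (s, x) = (y, t)\<close> stands for the edge from \<open>s\<close> to \<open>t\<close> labelled \<open>x|y\<close>.
\<close>

record ('s, 'x) automaton =
  states :: "'s set"
  alphabet :: "'x set"
  trans :: "'s \<times> 'x \<Rightarrow> 'x \<times> 's"

abbreviation words :: "('s, 'x) automaton \<Rightarrow> 'x list set" where
  "words A \<equiv> lists (alphabet A)"

primrec state_output :: "('s, 'x) automaton \<Rightarrow> 's \<Rightarrow> 'x list \<Rightarrow> 'x list" where
  "state_output A s [] = []"
| "state_output A s (x # xs) = fst (trans A (s, x)) # state_output A (snd (trans A (s, x))) xs"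

primrec state_section :: "('s, 'x) automaton \<Rightarrow> 's \<Rightarrow> 'x list \<Rightarrow> 's" where
  "state_section A s [] = s"
| "state_section A s (x # xs) = state_section A (snd (trans A (s, x))) xs"

text \<open>
  Transformations of \<open>words A\<close> are made extensional, i.e. \<open>undefined\<close> outside \<open>words A\<close>, so that
  equality of HOL functions is equality of transformations and they fit \<^const>\<open>BijGroup\<close>.
\<close>

definition transformation :: "('s, 'x) automaton \<Rightarrow> 's \<Rightarrow> 'x list \<Rightarrow> 'x list" where
  "transformation A s = restrict (state_output A s) (words A)"

definition trivial_transformation :: "('s, 'x) automaton \<Rightarrow> 'x list \<Rightarrow> 'x list" where
  "trivial_transformation A = (\<lambda>w \<in> words A. w)"

definition finite_automaton :: "('s, 'x) automaton \<Rightarrow> bool" where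
  "finite_automaton A \<longleftrightarrow>
     finite (alphabet A) \<and> card (alphabet A) \<ge> 2 \<and> finite (states A) \<and>
     trans A \<in> states A \<times> alphabet A \<rightarrow> alphabet A \<times> states A"

definition minimal_automaton :: "('s, 'x) automaton \<Rightarrow> bool" where
  "minimal_automaton A \<longleftrightarrow> inj_on (transformation A) (states A)"

definition invertible_automaton :: "('s, 'x) automaton \<Rightarrow> bool" where
  "invertible_automaton A \<longleftrightarrow>
     (\<forall>s \<in> states A. bij_betw (transformation A s) (words A) (words A))"

text \<open>
  All automata are required to be minimal, so minimality is part of the notion of a bounded
  automaton.
\<close>

definition bounded_automaton :: "('s, 'x) automaton \<Rightarrow> bool" where
  "bounded_automaton A \<longleftrightarrow>
     finite_automaton A \<and> minimal_automaton A \<and> invertible_automaton A \<and>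
     (\<exists>C. \<forall>n. \<forall>s \<in> states A.
        card {v \<in> words A. length v = n \<and>
                transformation A (state_section A s v) \<noteq> trivial_transformation A} \<le> C)"

definition automaton_group :: "('s, 'x) automaton \<Rightarrow> ('x list \<Rightarrow> 'x list) monoid" where
  "automaton_group A =
     BijGroup (words A)
       \<lparr>carrier := generate (BijGroup (words A)) (transformation A ` states A)\<rparr>"

text \<open>
  The natural extension to infinite words of a length- and prefix-preserving transformation \<open>g\<close>
  of the finite words: the \<open>i\<close>-th letter of the image is the last letter of the image of the
  prefix of length \<open>i + 1\<close>.
\<close>

definition omega_action :: "('x list \<Rightarrow> 'x list) \<Rightarrow> 'x word \<Rightarrow> 'x word" where
  "omega_action g w = (\<lambda>i. g (prefix (Suc i) w) ! i)"

lemma group_automaton_group: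
  assumes "invertible_automaton A"
  shows "group (automaton_group A)"
proof -
  interpret B: group "BijGroup (words A)" by (rule group_BijGroup)
  have "transformation A ` states A \<subseteq> carrier (BijGroup (words A))"
    using assms by (auto simp: invertible_automaton_def BijGroup_def Bij_def transformation_def)
  then show ?thesis
    unfolding automaton_group_def
    by (intro B.subgroup_imp_group B.generate_is_subgroup)
qed

lemma length_state_output [simp]: "length (state_output A s xs) = length xs"
  by (induction xs arbitrary: s) auto

lemma state_output_append:
  "state_output A s (xs @ ys) = state_output A s xs @ state_output A (state_section A s xs) ys"
  by (induction xs arbitrary: s) auto

lemma prefix_omega_action_transformation:
  assumes "range w \<subseteq> alphabet A"
  shows "prefix n (omega_action (transformation A s) w) = state_output A s (prefix n w)"
proof (rule nth_equalityI)
  fix i assume "i < length (prefix n (omega_action (transformation A s) w))"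
  then have i: "i < n" by simp
  have "[0..<n] = [0..<Suc i] @ [Suc i..<n]"
    using i upt_add_eq_append[of 0 "Suc i" "n - Suc i"] by simp
  then have "prefix n w = prefix (Suc i) w @ map w [Suc i..<n]"
    by (simp add: subsequence_def del: upt_Suc)
  moreover have "prefix (Suc i) w \<in> words A"
    using assms by (fastforce simp: subsequence_def)
  ultimately show "prefix n (omega_action (transformation A s) w) ! i = state_output A s (prefix n w) ! i"
    using i by (simp add: omega_action_def transformation_def state_output_append nth_append)
qed simp

text \<open>
  An algorithm is a program for a partial recursive function (zero, successor, projections,
  composition, primitive recursion, unbounded minimisation) in the sense of Kleene;
  \<open>evals p xs y\<close> says that the program \<open>p\<close> halts on the input tuple \<open>xs\<close> with result \<open>y\<close>.
\<close>

datatype recf =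
    Zero
  | Succ
  | Proj nat
  | Comp recf "recf list"
  | PrimRec recf recf
  | Mu recf

inductive evals :: "recf \<Rightarrow> nat list \<Rightarrow> nat \<Rightarrow> bool" where
  evals_Zero: "evals Zero xs 0"
| evals_Succ: "evals Succ [x] (Suc x)"
| evals_Proj: "i < length xs \<Longrightarrow> evals (Proj i) xs (xs ! i)"
| evals_Comp: "list_all2 (\<lambda>g y. evals g xs y) gs ys \<Longrightarrow> evals f ys z \<Longrightarrow> evals (Comp f gs) xs z"
| evals_PrimRec_0: "evals f xs z \<Longrightarrow> evals (PrimRec f g) (0 # xs) z"
| evals_PrimRec_Suc: "evals (PrimRec f g) (n # xs) r \<Longrightarrow> evals g (n # r # xs) z
    \<Longrightarrow> evals (PrimRec f g) (Suc n # xs) z"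
| evals_Mu: "evals f (n # xs) 0 \<Longrightarrow> (\<forall>m<n. \<exists>r. evals f (m # xs) (Suc r)) \<Longrightarrow> evals (Mu f) xs n"

inductive_cases evals_CompE: "evals (Comp f gs) xs y"
inductive_cases evals_PrimRec_0E: "evals (PrimRec f g) (0 # xs) y"
inductive_cases evals_PrimRec_SucE: "evals (PrimRec f g) (Suc n # xs) y"
inductive_cases evals_MuE: "evals (Mu f) xs y"

lemma evals_deterministic: "evals p xs y \<Longrightarrow> evals p xs z \<Longrightarrow> y = z"
proof (induction arbitrary: z rule: evals.induct)
  case (evals_Zero xs)
  then show ?case by cases auto
next
  case (evals_Succ x)
  then show ?case by cases auto
next
  case (evals_Proj i xs)
  from evals_Proj.prems show ?case by cases auto
next
  case (evals_Comp xs gs ys f z')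
  from evals_Comp.prems obtain ys' where
    ys': "list_all2 (\<lambda>g y. evals g xs y) gs ys'" and f: "evals f ys' z"
    by (rule evals_CompE)
  have "ys = ys'"
    using evals_Comp.IH(1) ys' by (auto simp: list_all2_conv_all_nth intro!: nth_equalityI)
  then show ?case using evals_Comp.IH(2) f by simp
next
  case (evals_PrimRec_0 f xs z g)
  from evals_PrimRec_0.prems show ?case
    by (rule evals_PrimRec_0E) (rule evals_PrimRec_0.IH)
next
  case (evals_PrimRec_Suc f g n xs r z')
  from evals_PrimRec_Suc.prems obtain r' where
    "evals (PrimRec f g) (n # xs) r'" and g: "evals g (n # r' # xs) z"
    by (rule evals_PrimRec_SucE)
  then have "r = r'" by (intro evals_PrimRec_Suc.IH(1))
  then show ?case using evals_PrimRec_Suc.IH(2) g by simp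
next
  case (evals_Mu f n xs)
  from evals_Mu.prems have z: "evals f (z # xs) 0" "\<forall>m<z. \<exists>r. evals f (m # xs) (Suc r)"
    by (auto elim: evals_MuE)
  show ?case
  proof (rule linorder_cases[of n z])
    assume "n < z"
    then obtain r where "evals f (n # xs) (Suc r)" using z(2) by blast
    then show ?thesis using evals_Mu.IH(1) by fastforce
  next
    assume "z < n"
    then show ?thesis using evals_Mu.IH(2) z(1) by fastforce
  qed simp
qed

text \<open>
  An automaton with \<open>n\<close> states over an alphabet of \<open>k\<close> letters is given to an algorithm with its
  states numbered \<open>0, \<dots>, n - 1\<close> and its letters numbered \<open>0, \<dots>, k - 1\<close>: the numbers \<open>k\<close> and
  \<open>n\<close>, and the table of the values of \<open>trans\<close> at \<open>(0,0), (0,1), \<dots>, (0,k-1), (1,0), \<dots>\<close>.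
\<close>

definition transition_table_code :: "(nat, nat) automaton \<Rightarrow> nat \<Rightarrow> nat \<Rightarrow> nat" where
  "transition_table_code A k n =
     list_encode (map (\<lambda>sx. prod_encode (trans A sx)) (List.product [0..<n] [0..<k]))"

definition input_code :: "nat \<Rightarrow> nat \<Rightarrow> (nat, nat) automaton \<Rightarrow> nat list \<Rightarrow> nat list \<Rightarrow> nat list" where
  "input_code k n A u v = [k, n, transition_table_code A k n, list_encode u, list_encode v]"

end

theory Submission
  imports Defs
begin

text \<open>
  Call level \<open>i\<close> branching if the stabiliser of the prefix of length \<open>i\<close> of \<open>w\<close> moves the next letter
  of \<open>w\<close>; the orbit of \<open>w\<close> is finite iff only finitely many levels are branching. The action graph on
  \<open>X\<^sup>i\<^sup>+\<^sup>1\<close> consists of one copy of the tile of level \<open>i\<close> (the edges \<open>v \<rightarrow> s(v)\<close> with trivial section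
  \<open>s|\<^sub>v\<close>) per letter, joined by edges that come from the pairs \<open>(s, v)\<close> with nontrivial \<open>s|\<^sub>v\<close>. In a
  bounded automaton over \<open>k\<close> letters with \<open>n\<close> states there are at most \<open>n k\<^sup>2\<^sup>n\<close> such pairs, so the sections
  at these pairs, together with the reachability within the tile between their end points and the prefix of
  \<open>w\<close>, form a finite amount of information. This information and the next letter of \<open>w\<close> determine both
  whether the level is branching and the information of the next level. For eventually periodic \<open>w\<close> the
  set of branching levels is therefore eventually periodic, with a computable bound \<open>N\<close> on preperiod plus
  period, and it suffices to look for a branching level in \<open>[N, 2N)\<close>, that is, for a word other than the
  prefix of \<open>w\<close> of length \<open>2N\<close> in the orbit of that prefix which has the same first \<open>N\<close> letters.
\<close>

section \<open>The number of active pairs of a bounded automaton\<close>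

definition trivial_state :: "('s, 'x) automaton \<Rightarrow> 's \<Rightarrow> bool" where
  "trivial_state A t \<longleftrightarrow> transformation A t = trivial_transformation A"

definition active_pairs :: "('s, 'x) automaton \<Rightarrow> nat \<Rightarrow> ('s \<times> 'x list) set" where
  "active_pairs A m = {(s, v). s \<in> states A \<and> v \<in> words A \<and> length v = m \<and>
     \<not> trivial_state A (state_section A s v)}"

lemma state_section_append:
  "state_section A s (xs @ ys) = state_section A (state_section A s xs) ys"
  by (induction xs arbitrary: s) auto

lemma trivial_state_iff: "trivial_state A t \<longleftrightarrow> (\<forall>x \<in> words A. state_output A t x = x)"
  unfolding trivial_state_def transformation_def trivial_transformation_def
  by (auto simp: fun_eq_iff restrict_def split: if_splits)

lemma trivial_state_step:
  assumes "trivial_state A t" "x \<in> alphabet A"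
  shows "fst (trans A (t, x)) = x" "trivial_state A (snd (trans A (t, x)))"
proof -
  have *: "state_output A t (x # ys) = x # ys" if "ys \<in> words A" for ys
  proof -
    have "x # ys \<in> words A" using assms(2) that by simp
    then show ?thesis using assms(1) unfolding trivial_state_iff by blast
  qed
  show "fst (trans A (t, x)) = x" using *[of "[]"] by simp
  show "trivial_state A (snd (trans A (t, x)))" using * by (simp add: trivial_state_iff)
qed

lemma trivial_state_section:
  "trivial_state A t \<Longrightarrow> v \<in> words A \<Longrightarrow> trivial_state A (state_section A t v)"
  by (induction v arbitrary: t) (auto simp: trivial_state_step)

section \<open>Powers of words and conjugacy\<close>

lemma set_concat_replicate: "set (concat (replicate r p)) \<subseteq> set p"
  by (induction r) auto

lemma length_concat_replicate: "length (concat (replicate r p)) = r * length p"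
  by (induction r) auto

lemma nth_concat_replicate:
  "i < r * length p \<Longrightarrow> concat (replicate r p) ! i = p ! (i mod length p)"
proof (induction r arbitrary: i)
  case (Suc r)
  show ?case
  proof (cases "i < length p")
    case False
    then have "i - length p < r * length p" using Suc.prems by auto
    then show ?thesis using False Suc.IH[of "i - length p"] by (simp add: nth_append le_mod_geq)
  qed (simp add: nth_append)
qed simp

lemma state_section_concat_replicate:
  "state_section A t p = t \<Longrightarrow> state_section A t (concat (replicate r p)) = t"
  by (induction r) (auto simp: state_section_append)

text \<open>The equation makes \<open>g\<close> a prefix of \<open>p^d g\<close>, so a letter behind
  the block \<open>p^d\<close> already occurs \<open>d * length p\<close> places earlier, and the
  period \<open>length p\<close> spreads by strong induction on the position.\<close>

lemma nth_of_conjugate: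
  assumes eq: "concat (replicate d p) @ g = g @ h" and "0 < d" "p \<noteq> []"
    and i: "i < d * length p + length g"
  shows "(concat (replicate d p) @ g) ! i = p ! (i mod length p)"
  using i
proof (induction i rule: less_induct)
  case (less i)
  show ?case
  proof (cases "i < d * length p")
    case True
    then show ?thesis by (simp add: nth_append length_concat_replicate nth_concat_replicate)
  next
    case False
    let ?j = "i - d * length p"
    have "0 < d * length p" using assms by simp
    then have j: "?j < i" "?j < length g" using False less.prems by linarith+
    have "(concat (replicate d p) @ g) ! i = g ! ?j"
      using False by (simp add: nth_append length_concat_replicate)
    also have "\<dots> = (concat (replicate d p) @ g) ! ?j" using eq j by (simp add: nth_append)
    also have "\<dots> = p ! (?j mod length p)" using less.IH[of ?j] j by simp
    also have "?j mod length p = i mod length p"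
    proof -
      have "i = ?j + d * length p" using False by simp
      then show ?thesis by (metis mod_mult_self1 mult.commute)
    qed
    finally show ?thesis .
  qed
qed

text \<open>Both \<open>p @ g\<close> and \<open>g @ q\<close> are initial segments of the word
  \<open>p^d g = g q^d\<close>, which has period \<open>length p\<close>; having the same length,
  they coincide.\<close>

lemma conjugate_of_power:
  assumes eq: "concat (replicate d p) @ g = g @ concat (replicate d q)" and "0 < d"
    and len: "length p = length q"
  shows "p @ g = g @ q"
proof (cases "p = []")
  case True
  then show ?thesis using len by simp
next
  case False
  have d: "d = Suc (d - 1)" using \<open>0 < d\<close> by simp
  have nth: "(concat (replicate d p) @ g) ! i = p ! (i mod length p)" if "i < length p + length g" for i
  proof -
    have "1 * length p \<le> d * length p" using \<open>0 < d\<close> by (intro mult_le_mono1) simp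
    then have "i < d * length p + length g" using that by linarith
    then show ?thesis by (rule nth_of_conjugate[OF eq \<open>0 < d\<close> False])
  qed
  have dq: "concat (replicate d q) = q @ concat (replicate (d - 1) q)"
    by (subst d) simp
  show ?thesis
  proof (rule nth_equalityI)
    fix i assume "i < length (p @ g)"
    then have i: "i < length p + length g" by simp
    have "i < length g \<or> i - length g < length q" using i len by linarith
    then have "(g @ q) ! i = (concat (replicate d p) @ g) ! i"
      unfolding eq dq by (auto simp: nth_append)
    then have r: "(g @ q) ! i = p ! (i mod length p)" using nth[OF i] by simp
    have "(p @ g) ! i = p ! (i mod length p)"
    proof (cases "i < length p")
      case False
      let ?j = "i - length p"
      have j: "?j < length g" using i False by simp
      have "g ! ?j = (concat (replicate d p) @ g) ! ?j" using eq j by (simp add: nth_append)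
      also have "\<dots> = p ! (?j mod length p)" using nth[of ?j] j by simp
      also have "?j mod length p = i mod length p" using False by (simp add: le_mod_geq)
      finally show ?thesis using False by (simp add: nth_append)
    qed (simp add: nth_append)
    then show "(p @ g) ! i = (g @ q) ! i" using r by simp
  qed (simp add: len)
qed

text \<open>
  Otherwise the words \<open>p\<^sup>a g q\<^sup>b\<close> with \<open>a + b = r\<close> are \<open>r + 1\<close> distinct active words of the same length.
\<close>

lemma bounded_automaton_cycles_conjugate:
  assumes A: "bounded_automaton A"
    and t: "t \<in> states A" and words: "p \<in> words A" "g \<in> words A" "q \<in> words A"
    and sec: "state_section A t p = t" "state_section A t g = t'" "state_section A t' q = t'"
    and active: "\<not> trivial_state A t'" and len: "length p = length q"
  shows "p @ g = g @ q"
proof (rule ccontr)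
  assume neq: "p @ g \<noteq> g @ q"
  obtain C where C: "\<And>n. card {v \<in> words A. length v = n \<and>
      transformation A (state_section A t v) \<noteq> trivial_transformation A} \<le> C"
    using A t unfolding bounded_automaton_def by blast
  have fin: "finite (alphabet A)" using A by (simp add: bounded_automaton_def finite_automaton_def)
  define f where "f a = concat (replicate a p) @ g @ concat (replicate (C - a) q)" for a
  let ?W = "{v \<in> words A. length v = C * length p + length g \<and>
      transformation A (state_section A t v) \<noteq> trivial_transformation A}"
  have "f ` {..C} \<subseteq> ?W"
  proof (rule image_subsetI)
    fix a assume "a \<in> {..C}"
    then have a: "a \<le> C" by simp
    have 1: "f a \<in> words A" unfolding f_def in_lists_conv_set set_append
      using words set_concat_replicate[of a p] set_concat_replicate[of "C - a" q]
      by (auto simp: in_lists_conv_set)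
    have "length (f a) = (a + (C - a)) * length p + length g"
      by (simp only: f_def length_append length_concat_replicate len add_mult_distrib)
    then have 2: "length (f a) = C * length p + length g" using a by simp
    have "state_section A t (f a) = t'"
      by (simp add: f_def state_section_append state_section_concat_replicate sec)
    then show "f a \<in> ?W" using 1 2 active by (simp add: trivial_state_def)
  qed
  moreover have "finite ?W"
    by (rule finite_subset[OF _ finite_lists_length_eq[OF fin, of "C * length p + length g"]])
      (auto simp: in_lists_conv_set)
  ultimately have "card (f ` {..C}) \<le> card ?W" by (intro card_mono)
  also have "\<dots> \<le> C" by (rule C)
  finally have "card (f ` {..C}) \<le> C" .
  moreover have "inj_on f {..C}"
  proof (rule linorder_inj_onI)
    fix a b assume ab: "a < b" "a \<in> {..C}" "b \<in> {..C}"
    define d where "d = b - a"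
    have d: "b = a + d" "C - a = d + (C - b)" "0 < d" using ab by (auto simp: d_def)
    show "f a \<noteq> f b"
    proof
      assume "f a = f b"
      \<comment> \<open>Cancelling the common prefix \<open>p^a\<close> and the common suffix
        \<open>q^(C - b)\<close> in \<open>f a = f b\<close> leaves an equation between the
        \<open>d\<close>-th powers, where \<open>d\<close> is the difference of the
        exponents.\<close>
      then have "g @ concat (replicate d q) = concat (replicate d p) @ g"
        unfolding f_def d(2) d(1) replicate_add concat_append by simp
      then show False using conjugate_of_power[of d p g q] d len neq by simp
    qed
  qed auto
  ultimately show False by (simp add: card_image)
qed

section \<open>Periodicity and number of active words\<close>

lemma state_section_in_states:
  assumes "finite_automaton A"
  shows "s \<in> states A \<Longrightarrow> v \<in> words A \<Longrightarrow> state_section A s v \<in> states A"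
proof (induction v arbitrary: s)
  case (Cons x v)
  then have "trans A (s, x) \<in> alphabet A \<times> states A"
    using assms by (auto simp: finite_automaton_def)
  then show ?case using Cons by auto
qed simp

lemma state_output_in_words:
  assumes "finite_automaton A"
  shows "s \<in> states A \<Longrightarrow> v \<in> words A \<Longrightarrow> state_output A s v \<in> words A"
proof (induction v arbitrary: s)
  case (Cons x v)
  then have "trans A (s, x) \<in> alphabet A \<times> states A"
    using assms by (auto simp: finite_automaton_def)
  then show ?case using Cons.IH[of "snd (trans A (s, x))"] Cons.prems by (simp add: mem_Times_iff)
qed simp

text \<open>Pigeonhole on the \<open>card (states A) + 1\<close> prefix lengths from
  \<open>a\<close> on. The offset \<open>a\<close> serves to find a cycle near the end of a word as
  well as near its beginning.\<close>

lemma ex_repeated_section: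
  assumes A: "finite_automaton A" and s: "s \<in> states A" and v: "v \<in> words A"
  shows "\<exists>i j. a \<le> i \<and> i < j \<and> j \<le> a + card (states A) \<and>
    state_section A s (take i v) = state_section A s (take j v)"
proof (rule ccontr)
  assume *: "\<not> ?thesis"
  let ?f = "\<lambda>i. state_section A s (take i v)"
  have "inj_on ?f {a..a + card (states A)}"
    using * by (intro linorder_inj_onI) auto
  moreover have "take i v \<in> words A" for i using v by (auto simp: in_lists_conv_set dest: in_set_takeD)
  then have "?f ` {a..a + card (states A)} \<subseteq> states A"
    using A s by (auto simp: state_section_in_states)
  moreover have "finite (states A)" using A by (simp add: finite_automaton_def)
  ultimately show False using card_inj_on_le[of ?f "{a..a + card (states A)}" "states A"] by simp
qed

text \<open>
  The section repeats along the first \<open>card (states A)\<close> letters, on a closed path \<open>p\<close>, and along the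
  last ones, on a closed path \<open>q\<close>. Suitable powers of \<open>p\<close> and \<open>q\<close> have the same length, hence are
  conjugate by the word \<open>g\<close> read in between, which makes \<open>g\<close> a prefix of \<open>ppp\<dots>\<close>.
\<close>

lemma active_word_periodic:
  assumes A: "bounded_automaton A" and s: "s \<in> states A"
    and v: "v \<in> words A" "\<not> trivial_state A (state_section A s v)"
    and len: "2 * card (states A) \<le> length v"
    and p: "i < j" "j \<le> card (states A)" "state_section A s (take i v) = state_section A s (take j v)"
    and r: "j \<le> r" "r < length v - card (states A)"
  shows "v ! r = v ! (i + (r - j) mod (j - i))"
proof -
  let ?n = "card (states A)"
  have fin: "finite_automaton A" using A by (simp add: bounded_automaton_def)
  obtain l l' where l: "length v - ?n \<le> l" "l < l'" "l' \<le> length v"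
    and secl: "state_section A s (take l v) = state_section A s (take l' v)"
    using ex_repeated_section[OF fin s v(1), of "length v - ?n"] len by auto
  define p where "p = take (j - i) (drop i v)"
  define q where "q = take (l' - l) (drop l v)"
  define g where "g = take (l - j) (drop j v)"
  define t where "t = state_section A s (take j v)"
  define t' where "t' = state_section A s (take l v)"
  have sub: "take a (drop b v) \<in> words A" for a b
    using v(1) by (auto simp: in_lists_conv_set dest!: in_set_takeD in_set_dropD)
  have tk: "take b v = take a v @ take (b - a) (drop a v)" if "a \<le> b" for a b
    using that take_add[of a "b - a" v] by simp
  have tp: "state_section A t p = t"
    using assms(6,8) tk[of i j] by (simp add: t_def p_def state_section_append)
  have tg: "state_section A t g = t'"
    using r l tk[of j l] by (simp add: t_def g_def t'_def state_section_append)
  have tq: "state_section A t' q = t'"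
    using secl l tk[of l l'] by (simp add: t'_def q_def state_section_append)
  \<comment> \<open>A trivial section would stay trivial along the remaining letters of
    \<open>v\<close>.\<close>
  have act: "\<not> trivial_state A t'"
  proof
    assume "trivial_state A t'"
    moreover have "v = take l v @ drop l v" by simp
    moreover have "drop l v \<in> words A" using v(1) by (auto simp: in_lists_conv_set dest: in_set_dropD)
    ultimately show False
      using v(2) trivial_state_section[of A t' "drop l v"] state_section_append[of A s "take l v" "drop l v"]
      by (simp add: t'_def)
  qed
  have tin: "t \<in> states A"
    using state_section_in_states[OF fin s, of "take j v"] sub[of j 0] by (simp add: t_def)
  have lens: "length p = j - i" "length q = l' - l" "length g = l - j"
    using assms(6,7) l len by (auto simp: p_def q_def g_def)
  \<comment> \<open>The closed paths have lengths \<open>j - i\<close> and \<open>l' - l\<close>;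
    taking each length as the exponent of the other path gives powers of equal length.\<close>
  have "concat (replicate (l' - l) p) @ g = g @ concat (replicate (j - i) q)"
  proof (rule bounded_automaton_cycles_conjugate[OF A tin])
    show "concat (replicate (l' - l) p) \<in> words A" "concat (replicate (j - i) q) \<in> words A"
      using sub[of "j - i" i] sub[of "l' - l" l] set_concat_replicate[of "l' - l" p]
        set_concat_replicate[of "j - i" q]
      by (auto simp: in_lists_conv_set p_def q_def)
    show "g \<in> words A" by (simp add: g_def sub)
    show "length (concat (replicate (l' - l) p)) = length (concat (replicate (j - i) q))"
      by (simp add: length_concat_replicate lens)
  qed (use tp tg tq act in \<open>simp_all add: state_section_concat_replicate\<close>)
  note eq = this
  have rl: "r - j < length g" using r l lens by auto
  have pne: "p \<noteq> []" using lens assms(6) by auto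
  have "v ! r = g ! (r - j)" using r l by (simp add: g_def)
  also have "\<dots> = (concat (replicate (l' - l) p) @ g) ! (r - j)"
    using rl by (simp only: eq) (simp add: nth_append)
  also have "\<dots> = p ! ((r - j) mod length p)"
    using rl l by (intro nth_of_conjugate[OF eq _ pne]) auto
  also have "\<dots> = v ! (i + (r - j) mod (j - i))"
    using assms(6,7) len by (simp add: lens) (simp add: p_def)
  finally show ?thesis .
qed

text \<open>Counts the triples of a state and two words of length \<open>n\<close>, meant as the
  first and the last \<open>n\<close> letters of an active word.\<close>

definition active_bound :: "nat \<Rightarrow> nat \<Rightarrow> nat" where
  "active_bound k n = n * (k ^ n * k ^ n)"

lemma finite_words_length:
  "finite (alphabet A) \<Longrightarrow> finite {v \<in> words A. length v = m}"
  using finite_lists_length_eq[of "alphabet A" m] by (simp add: in_lists_conv_set subset_eq conj_commute)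

lemma card_words_length:
  "finite (alphabet A) \<Longrightarrow> card {v \<in> words A. length v = m} = card (alphabet A) ^ m"
  using card_lists_length_eq[of "alphabet A" m] by (simp add: in_lists_conv_set subset_eq conj_commute)

lemma finite_active_pairs:
  assumes "finite_automaton A"
  shows "finite (active_pairs A m)"
proof (rule finite_subset)
  show "active_pairs A m \<subseteq> states A \<times> {v \<in> words A. length v = m}"
    by (auto simp: active_pairs_def)
  show "finite (states A \<times> {v \<in> words A. length v = m})"
    using assms by (simp add: finite_automaton_def finite_words_length)
qed

text \<open>Let \<open>n = card (states A)\<close>. Words shorter than \<open>2 n\<close> are
  counted outright. In a longer active word the middle letters repeat a cycle visible in the first
  \<open>n\<close> letters, so the state and the first and last \<open>n\<close> letters determine
  the pair.\<close>

lemma card_active_pairs: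
  assumes A: "bounded_automaton A"
  shows "card (active_pairs A m) \<le> active_bound (card (alphabet A)) (card (states A))"
proof -
  let ?n = "card (states A)" and ?k = "card (alphabet A)"
  let ?W = "\<lambda>m. {v \<in> words A. length v = m}"
  have fin: "finite_automaton A" using A by (simp add: bounded_automaton_def)
  then have fa: "finite (alphabet A)" "finite (states A)" "2 \<le> ?k" by (auto simp: finite_automaton_def)
  show ?thesis
  proof (cases "m < 2 * ?n")
    case True
    have "card (active_pairs A m) \<le> card (states A \<times> ?W m)"
      by (rule card_mono) (auto simp: active_pairs_def finite_words_length fa)
    also have "\<dots> = ?n * ?k ^ m" by (simp add: card_cartesian_product card_words_length fa)
    also have "\<dots> \<le> ?n * ?k ^ (2 * ?n)"
      using True fa by (intro mult_le_mono2 power_increasing) auto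
    finally show ?thesis by (simp add: active_bound_def power_add[symmetric] mult_2)
  next
    case False
    let ?f = "\<lambda>(s, v). (s, take ?n v, drop (m - ?n) v)"
    have inj: "inj_on ?f (active_pairs A m)"
    proof (rule inj_onI, clarsimp)
      fix s v v'
      assume "(s, v) \<in> active_pairs A m" and "(s, v') \<in> active_pairs A m"
        and pre: "take ?n v = take ?n v'" and suf: "drop (m - ?n) v = drop (m - ?n) v'"
      then have v: "s \<in> states A" "v \<in> words A" "length v = m" "\<not> trivial_state A (state_section A s v)"
        and v': "v' \<in> words A" "length v' = m" "\<not> trivial_state A (state_section A s v')"
        by (auto simp: active_pairs_def)
      obtain i j where ij: "i < j" "j \<le> ?n" and sec: "state_section A s (take i v) = state_section A s (take j v)"
        using ex_repeated_section[OF fin v(1,2), of 0] by auto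
      have tk: "take l v = take l v'" if "l \<le> ?n" for l
        using pre that by (metis min.absorb1 take_take)
      have early: "v ! r = v' ! r" if "r < ?n" for r
        using pre that by (metis nth_take)
      show "v = v'"
      proof (rule nth_equalityI)
        fix r assume r: "r < length v"
        consider "r < ?n" | "m - ?n \<le> r" | "?n \<le> r" "r < m - ?n" by linarith
        then show "v ! r = v' ! r"
        proof cases
          case 1
          then show ?thesis by (rule early)
        next
          case 2
          then show ?thesis using suf r v(3) v'(2)
            by (metis le_add_diff_inverse nth_drop less_imp_le_nat diff_le_self)
        next
          case 3
          \<comment> \<open>The prefixes of lengths \<open>i\<close> and \<open>j\<close> lie within
            the common first \<open>?n\<close> letters, so the same \<open>i\<close> and
            \<open>j\<close> mark a cycle in both words, and both middle letters are copies of the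
            same early letter.\<close>
          have le: "i + (r - j) mod (j - i) < ?n"
            using ij mod_less_divisor[of "j - i" "r - j"] by linarith
          have "v ! r = v ! (i + (r - j) mod (j - i))"
            using 3 False v ij by (intro active_word_periodic[OF A v(1,2,4) _ ij sec]) auto
          also have "\<dots> = v' ! (i + (r - j) mod (j - i))" using early[OF le] .
          also have "\<dots> = v' ! r"
            using 3 False v v' ij sec tk
            by (intro active_word_periodic[OF A v(1) v'(1,3) _ ij, symmetric]) auto
          finally show ?thesis .
        qed
      qed (simp add: v v')
    qed
    have "?f ` active_pairs A m \<subseteq> states A \<times> ?W ?n \<times> ?W ?n"
      using False by (auto simp: active_pairs_def in_lists_conv_set dest: in_set_takeD in_set_dropD)
    then have "card (active_pairs A m) \<le> card (states A \<times> ?W ?n \<times> ?W ?n)"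
      by (intro card_inj_on_le[OF inj]) (auto simp: fa finite_words_length)
    then show ?thesis by (simp add: card_cartesian_product card_words_length fa active_bound_def)
  qed
qed

section \<open>Self-similarity of the action graphs\<close>

text \<open>The parameter \<open>P\<close> selects edges of the action graph by their section:
  triviality gives the tile, the constant truth the whole graph. The self-similarity argument then
  covers both at once.\<close>

definition step_rel :: "('s, 'x) automaton \<Rightarrow> ('s \<Rightarrow> bool) \<Rightarrow> ('x list \<times> 'x list) set" where
  "step_rel A P = {(v, state_output A s v) | s v.
     s \<in> states A \<and> v \<in> words A \<and> P (state_section A s v)}"

abbreviation inert_rel :: "('s, 'x) automaton \<Rightarrow> ('x list \<times> 'x list) set" where
  "inert_rel A \<equiv> step_rel A (trivial_state A)"

abbreviation full_rel :: "('s, 'x) automaton \<Rightarrow> ('x list \<times> 'x list) set" where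
  "full_rel A \<equiv> step_rel A (\<lambda>_. True)"

text \<open>Paths use forward edges only. For an invertible automaton this is still the orbit
  relation, since each state permutes the finitely many words of a given length.\<close>

definition branching :: "('s, 'x) automaton \<Rightarrow> 'x word \<Rightarrow> nat \<Rightarrow> bool" where
  "branching A w i \<longleftrightarrow> (\<exists>y \<in> alphabet A. y \<noteq> w i \<and>
     (prefix (Suc i) w, prefix i w @ [y]) \<in> (full_rel A)\<^sup>*)"

text \<open>Points are names for the marked vertices of a level: the prefix of \<open>w\<close>, and
  the source (\<open>False\<close>) and target (\<open>True\<close>) of each active pair. Several
  names may denote the same word; names, unlike words, can be carried to another level by a map of
  active pairs.\<close>

type_synonym ('s, 'x) point = "(('s \<times> 'x list) \<times> bool) option"

definition points :: "('s, 'x) automaton \<Rightarrow> nat \<Rightarrow> ('s, 'x) point set" where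
  "points A i = insert None (Some ` (active_pairs A i \<times> UNIV))"

fun vertex :: "('s, 'x) automaton \<Rightarrow> 'x word \<Rightarrow> nat \<Rightarrow> ('s, 'x) point \<Rightarrow> 'x list" where
  "vertex A w i None = prefix i w"
| "vertex A w i (Some ((s, v), False)) = v"
| "vertex A w i (Some ((s, v), True)) = state_output A s v"

text \<open>
  Reachability for \<open>transfer\<close> between pairs \<open>(\<alpha>, x)\<close> amounts to reachability between the words
  \<open>vertex \<alpha> @ [x]\<close> of level \<open>i + 1\<close>: in the tile if \<open>P\<close> is triviality, in the whole action graph if \<open>P\<close>
  holds everywhere.
\<close>

definition transfer ::
  "('s, 'x) automaton \<Rightarrow> 'x word \<Rightarrow> ('s \<Rightarrow> bool) \<Rightarrow> nat \<Rightarrow> ((('s, 'x) point \<times> 'x) \<times> (('s, 'x) point \<times> 'x)) set"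
where
  "transfer A w P i =
     {((\<alpha>, x), (\<beta>, x)) | \<alpha> \<beta> x. \<alpha> \<in> points A i \<and> \<beta> \<in> points A i \<and> x \<in> alphabet A \<and>
        (vertex A w i \<alpha>, vertex A w i \<beta>) \<in> (inert_rel A)\<^sup>*} \<union>
     {((Some (a, False), x), (Some (a, True), y)) | a x y. a \<in> active_pairs A i \<and> x \<in> alphabet A \<and>
        y = fst (trans A (case_prod (state_section A) a, x)) \<and>
        P (snd (trans A (case_prod (state_section A) a, x)))}"

text \<open>Splits a marked vertex of level \<open>i + 1\<close> into a marked vertex of level
  \<open>i\<close> and a last letter. A shortened active pair is again active because the sections
  of a trivial state are trivial.\<close>

fun origin :: "('s, 'x) automaton \<Rightarrow> 'x word \<Rightarrow> nat \<Rightarrow> ('s, 'x) point \<Rightarrow> ('s, 'x) point \<times> 'x" where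
  "origin A w i None = (None, w i)"
| "origin A w i (Some ((s, v), False)) = (Some ((s, butlast v), False), last v)"
| "origin A w i (Some ((s, v), True)) =
     (Some ((s, butlast v), True), fst (trans A (state_section A s (butlast v), last v)))"

abbreviation map_point :: "('s \<times> 'x list \<Rightarrow> 'a) \<Rightarrow> ('s, 'x) point \<Rightarrow> ('a \<times> bool) option" where
  "map_point \<phi> \<equiv> map_option (map_prod \<phi> id)"

text \<open>Says that the information of level \<open>i\<close> occurs in that of level
  \<open>j\<close>. Preservation in one direction is demanded, and levels with equal information are
  compared by two such maps.\<close>

definition info_hom ::
  "('s, 'x) automaton \<Rightarrow> 'x word \<Rightarrow> ('s \<times> 'x list \<Rightarrow> 's \<times> 'x list) \<Rightarrow> nat \<Rightarrow> nat \<Rightarrow> bool"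
where
  "info_hom A w \<phi> i j \<longleftrightarrow>
     (\<forall>a \<in> active_pairs A i. \<phi> a \<in> active_pairs A j \<and>
        case_prod (state_section A) (\<phi> a) = case_prod (state_section A) a) \<and>
     (\<forall>\<alpha> \<in> points A i. \<forall>\<beta> \<in> points A i. (vertex A w i \<alpha>, vertex A w i \<beta>) \<in> (inert_rel A)\<^sup>* \<longrightarrow>
        (vertex A w j (map_point \<phi> \<alpha>), vertex A w j (map_point \<phi> \<beta>)) \<in> (inert_rel A)\<^sup>*)"

definition extend_pair :: "('s \<times> 'x list \<Rightarrow> 's \<times> 'x list) \<Rightarrow> 's \<times> 'x list \<Rightarrow> 's \<times> 'x list" where
  "extend_pair \<phi> = (\<lambda>(s, v). map_prod id (\<lambda>v'. v' @ [last v]) (\<phi> (s, butlast v)))"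

lemma active_pairs_snoc:
  "(s, v @ [x]) \<in> active_pairs A (Suc i) \<longleftrightarrow> (s, v) \<in> active_pairs A i \<and> x \<in> alphabet A \<and>
     \<not> trivial_state A (snd (trans A (state_section A s v, x)))"
  by (auto simp: active_pairs_def state_section_append dest: trivial_state_step)

lemma active_pairs_SucE:
  assumes "a \<in> active_pairs A (Suc i)"
  obtains s v x where "a = (s, v @ [x])" "(s, v) \<in> active_pairs A i" "x \<in> alphabet A"
proof -
  obtain s u where a: "a = (s, u)" by (cases a)
  show ?thesis
  proof (cases u rule: rev_cases)
    case Nil
    then show ?thesis using assms a by (simp add: active_pairs_def)
  next
    case (snoc v x)
    then show ?thesis using assms that unfolding a snoc active_pairs_snoc by blast
  qed
qed

lemma points_cases [consumes 1, case_names None source target]: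
  assumes "\<alpha> \<in> points A i"
  obtains "\<alpha> = None" | s v where "\<alpha> = Some ((s, v), False)" "(s, v) \<in> active_pairs A i"
    | s v where "\<alpha> = Some ((s, v), True)" "(s, v) \<in> active_pairs A i"
  using assms unfolding points_def by auto

lemma None_in_points [simp]: "None \<in> points A i"
  by (simp add: points_def)

lemma Some_in_points [simp]: "Some (a, b) \<in> points A i \<longleftrightarrow> a \<in> active_pairs A i"
  by (auto simp: points_def)

locale word_automaton =
  fixes A :: "('s, 'x) automaton" and w :: "'x word"
  assumes finite_automaton: "finite_automaton A" and range_word: "range w \<subseteq> alphabet A"
begin

lemma trans_in:
  "s \<in> states A \<Longrightarrow> x \<in> alphabet A \<Longrightarrow> fst (trans A (s, x)) \<in> alphabet A \<and> snd (trans A (s, x)) \<in> states A"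
  using finite_automaton by (fastforce simp: finite_automaton_def Pi_iff)

lemma prefix_in_words [simp]: "prefix i w \<in> words A"
  using range_word by (auto simp: in_lists_conv_set)

lemma word_in [simp]: "w i \<in> alphabet A"
  using range_word by auto

lemma step_rel_closed:
  "(a, b) \<in> (step_rel A P)\<^sup>* \<Longrightarrow> a \<in> words A \<Longrightarrow> b \<in> words A \<and> length b = length a"
proof (induction rule: rtrancl_induct)
  case (step b c)
  then show ?case
    using state_output_in_words[OF finite_automaton] by (auto simp: step_rel_def)
qed simp

lemma vertex_in:
  assumes "\<alpha> \<in> points A i"
  shows "vertex A w i \<alpha> \<in> words A \<and> length (vertex A w i \<alpha>) = i"
  using assms
  by (cases rule: points_cases)
    (auto simp: active_pairs_def state_output_in_words[OF finite_automaton] simp del: in_lists_conv_set)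

text \<open>A trivial section fixes the appended letter and is followed by a trivial section, so
  each edge of the tile lifts to an edge of the copy indexed by \<open>x\<close>.\<close>

lemma inert_rel_snoc:
  assumes "(a, b) \<in> (inert_rel A)\<^sup>*" "x \<in> alphabet A" "\<And>t. trivial_state A t \<Longrightarrow> P t"
  shows "(a @ [x], b @ [x]) \<in> (step_rel A P)\<^sup>*"
  using assms(1)
proof (induction rule: rtrancl_induct)
  case (step b c)
  then obtain s where s: "c = state_output A s b" "s \<in> states A" "b \<in> words A"
    "trivial_state A (state_section A s b)"
    by (auto simp: step_rel_def)
  have "(b @ [x], state_output A s (b @ [x])) \<in> step_rel A P"
    using s assms(2) trivial_state_step(2)[OF s(4) assms(2)] assms(3)
    unfolding step_rel_def by (fastforce simp: state_section_append)
  moreover have "state_output A s (b @ [x]) = c @ [x]"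
    using s trivial_state_step(1)[OF s(4) assms(2)] by (simp add: state_output_append)
  ultimately show ?case using step.IH by simp
qed simp

lemma transfer_sound:
  assumes "((\<alpha>, x), (\<beta>, y)) \<in> (transfer A w P i)\<^sup>*" "\<And>t. trivial_state A t \<Longrightarrow> P t"
  shows "(vertex A w i \<alpha> @ [x], vertex A w i \<beta> @ [y]) \<in> (step_rel A P)\<^sup>*"
  using assms(1)
proof (induction rule: rtrancl_induct2)
  case (step \<beta> y \<gamma> z)
  from step(2) have "(vertex A w i \<beta> @ [y], vertex A w i \<gamma> @ [z]) \<in> (step_rel A P)\<^sup>*"
    unfolding transfer_def
  proof (elim UnE CollectE exE conjE)
    fix \<alpha>' \<beta>' x'
    assume "((\<beta>, y), \<gamma>, z) = ((\<alpha>', x'), \<beta>', x')" "x' \<in> alphabet A"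
      "(vertex A w i \<alpha>', vertex A w i \<beta>') \<in> (inert_rel A)\<^sup>*"
    then show ?thesis using inert_rel_snoc[OF _ _ assms(2)] by simp
  next
    fix a x' y'
    assume *: "((\<beta>, y), \<gamma>, z) = ((Some (a, False), x'), Some (a, True), y')" "a \<in> active_pairs A i"
      "x' \<in> alphabet A" "y' = fst (trans A (case_prod (state_section A) a, x'))"
      "P (snd (trans A (case_prod (state_section A) a, x')))"
    obtain s v where a: "a = (s, v)" by (cases a)
    have "s \<in> states A" "v @ [x'] \<in> words A" "P (state_section A s (v @ [x']))"
      using * by (auto simp: a active_pairs_def state_section_append)
    then have "(v @ [x'], state_output A s (v @ [x'])) \<in> step_rel A P"
      unfolding step_rel_def by blast
    then show ?thesis using * by (simp add: a state_output_append r_into_rtrancl)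
  qed
  then show ?case using step(3) by (rule rtrancl_trans[rotated])
qed simp

text \<open>
  A path in the tile of level \<open>i + 1\<close> stays in one of the copies of the tile of level \<open>i\<close> except
  when it passes through an active pair, so only the position of the last such passage has to be
  remembered.
\<close>

lemma transfer_complete:
  assumes "(vertex A w i \<alpha> @ [x], z) \<in> (step_rel A P)\<^sup>*" and \<alpha>: "\<alpha> \<in> points A i" "x \<in> alphabet A"
  shows "\<exists>\<beta> y b. \<beta> \<in> points A i \<and> y \<in> alphabet A \<and> z = b @ [y] \<and>
    ((\<alpha>, x), (\<beta>, y)) \<in> (transfer A w P i)\<^sup>* \<and> (vertex A w i \<beta>, b) \<in> (inert_rel A)\<^sup>*"
  using assms(1)
proof (induction rule: rtrancl_induct)
  case base
  then show ?case using \<alpha> by blast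
next
  case (step z z')
  then obtain \<beta> y b where \<beta>: "\<beta> \<in> points A i" "y \<in> alphabet A" "z = b @ [y]"
    "((\<alpha>, x), (\<beta>, y)) \<in> (transfer A w P i)\<^sup>*" "(vertex A w i \<beta>, b) \<in> (inert_rel A)\<^sup>*"
    by blast
  obtain s where s: "z' = state_output A s z" "s \<in> states A" "P (state_section A s z)"
    using step(2) by (auto simp: step_rel_def)
  let ?t = "state_section A s b"
  have b: "b \<in> words A" "length b = i" using step_rel_closed[OF \<beta>(5)] vertex_in[OF \<beta>(1)] by auto
  have z': "z' = state_output A s b @ [fst (trans A (?t, y))]" using s \<beta>(3) by (simp add: state_output_append)
  show ?case
  proof (cases "trivial_state A ?t")
    case True
    have "(b, state_output A s b) \<in> inert_rel A" using True s b unfolding step_rel_def by blast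
    then have "(vertex A w i \<beta>, state_output A s b) \<in> (inert_rel A)\<^sup>*" using \<beta>(5) by simp
    then show ?thesis using z' \<beta> trivial_state_step(1)[OF True \<beta>(2)] by auto
  next
    case False
    then have act: "(s, b) \<in> active_pairs A i" using s b by (simp add: active_pairs_def)
    \<comment> \<open>The word \<open>b\<close> is the source of the pair \<open>(s, b)\<close>: the
      tile path leading to \<open>b\<close> becomes one move, the crossing a second one, and from
      now on the target of the pair is remembered.\<close>
    have "((\<beta>, y), (Some ((s, b), False), y)) \<in> transfer A w P i"
      using \<beta> act unfolding transfer_def by fastforce
    moreover have "((Some ((s, b), False), y), (Some ((s, b), True), fst (trans A (?t, y)))) \<in> transfer A w P i"
      using act \<beta>(2,3) s(3) unfolding transfer_def by (auto simp: state_section_append)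
    ultimately have "((\<alpha>, x), (Some ((s, b), True), fst (trans A (?t, y)))) \<in> (transfer A w P i)\<^sup>*"
      using \<beta>(4) by (meson rtrancl.rtrancl_into_rtrancl)
    moreover have "?t \<in> states A" using state_section_in_states[OF finite_automaton s(2) b(1)] .
    ultimately show ?thesis using act trans_in \<beta>(2) z'
      by (intro exI[of _ "Some ((s, b), True)"] exI[of _ "fst (trans A (?t, y))"] exI[of _ "state_output A s b"])
        auto
  qed
qed

lemma transfer_rtrancl_iff:
  assumes P: "\<And>t. trivial_state A t \<Longrightarrow> P t" and "\<alpha> \<in> points A i" "x \<in> alphabet A" "\<beta> \<in> points A i"
  shows "((\<alpha>, x), (\<beta>, y)) \<in> (transfer A w P i)\<^sup>* \<longleftrightarrow>
    (vertex A w i \<alpha> @ [x], vertex A w i \<beta> @ [y]) \<in> (step_rel A P)\<^sup>*"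
proof
  assume "(vertex A w i \<alpha> @ [x], vertex A w i \<beta> @ [y]) \<in> (step_rel A P)\<^sup>*"
  from transfer_complete[OF this assms(2,3)] obtain \<gamma> where
    \<gamma>: "\<gamma> \<in> points A i" "y \<in> alphabet A" "((\<alpha>, x), (\<gamma>, y)) \<in> (transfer A w P i)\<^sup>*"
    "(vertex A w i \<gamma>, vertex A w i \<beta>) \<in> (inert_rel A)\<^sup>*"
    by auto
  \<comment> \<open>The simulated path ends at a point \<gamma> from which the vertex of \<beta> is
    reachable in the tile, so one further move within the same copy leads to \<beta>.\<close>
  then have "((\<gamma>, y), (\<beta>, y)) \<in> transfer A w P i" using assms(4) unfolding transfer_def by blast
  then show "((\<alpha>, x), (\<beta>, y)) \<in> (transfer A w P i)\<^sup>*" using \<gamma>(3) by simp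
qed (rule transfer_sound[OF _ P])

section \<open>Maps between the information of two levels\<close>

lemma info_hom_points:
  "info_hom A w \<phi> i j \<Longrightarrow> \<alpha> \<in> points A i \<Longrightarrow> map_point \<phi> \<alpha> \<in> points A j"
  by (auto simp: info_hom_def elim!: points_cases)

text \<open>The moves of \<open>transfer\<close> are given by tile reachability between points and
  by the sections at active pairs; \<phi> preserves both, and the letters stay the same.\<close>

lemma info_hom_transfer:
  assumes \<phi>: "info_hom A w \<phi> i j" and "(p, q) \<in> (transfer A w P i)\<^sup>*"
  shows "(map_prod (map_point \<phi>) id p, map_prod (map_point \<phi>) id q) \<in> (transfer A w P j)\<^sup>*"
  using assms(2)
proof (induction rule: rtrancl_induct)
  case (step q r)
  from step(2)[unfolded transfer_def]
  have "(map_prod (map_point \<phi>) id q, map_prod (map_point \<phi>) id r) \<in> transfer A w P j"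
  proof (elim UnE CollectE exE conjE)
    fix \<alpha> \<beta> x
    assume "(q, r) = ((\<alpha>, x), \<beta>, x)" "\<alpha> \<in> points A i" "\<beta> \<in> points A i" "x \<in> alphabet A"
      "(vertex A w i \<alpha>, vertex A w i \<beta>) \<in> (inert_rel A)\<^sup>*"
    then show ?thesis
      using \<phi> info_hom_points[OF \<phi>] unfolding transfer_def info_hom_def by simp
  next
    fix a x y
    assume "(q, r) = ((Some (a, False), x), Some (a, True), y)" "a \<in> active_pairs A i" "x \<in> alphabet A"
      "y = fst (trans A (case_prod (state_section A) a, x))"
      "P (snd (trans A (case_prod (state_section A) a, x)))"
    moreover obtain s v s' v' where "a = (s, v)" "\<phi> a = (s', v')" by (metis surj_pair)
    moreover from this have "(s', v') \<in> active_pairs A j" "state_section A s' v' = state_section A s v"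
      using \<phi> \<open>a \<in> active_pairs A i\<close> unfolding info_hom_def by fastforce+
    ultimately show ?thesis unfolding transfer_def by simp
  qed
  with step.IH show ?case by (rule rtrancl.rtrancl_into_rtrancl)
qed simp

lemma origin_props:
  assumes "\<alpha> \<in> points A (Suc i)"
  shows "fst (origin A w i \<alpha>) \<in> points A i" "snd (origin A w i \<alpha>) \<in> alphabet A"
    "vertex A w (Suc i) \<alpha> = vertex A w i (fst (origin A w i \<alpha>)) @ [snd (origin A w i \<alpha>)]"
proof -
  have sec: "state_section A s v \<in> states A" if "(s, v) \<in> active_pairs A i" for s v
    using that state_section_in_states[OF finite_automaton] by (simp add: active_pairs_def)
  show "fst (origin A w i \<alpha>) \<in> points A i" "snd (origin A w i \<alpha>) \<in> alphabet A"
    "vertex A w (Suc i) \<alpha> = vertex A w i (fst (origin A w i \<alpha>)) @ [snd (origin A w i \<alpha>)]"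
    using assms
    by (cases rule: points_cases; auto elim!: active_pairs_SucE dest: sec simp: state_output_append trans_in)+
qed

text \<open>The last letter of a target depends only on the section at the shortened pair, which
  \<phi> preserves, and that of the prefix of \<open>w\<close> is covered by
  \<open>w i = w j\<close>.\<close>

lemma origin_hom:
  assumes \<phi>: "info_hom A w \<phi> i j" and "w i = w j" and "\<alpha> \<in> points A (Suc i)"
  shows "origin A w j (map_point (extend_pair \<phi>) \<alpha>) = map_prod (map_point \<phi>) id (origin A w i \<alpha>)"
proof -
  have sec: "state_section A s' v' = state_section A s v" if "(s, v) \<in> active_pairs A i" "\<phi> (s, v) = (s', v')" for s v s' v'
    using \<phi> that unfolding info_hom_def by fastforce
  from assms(3) show ?thesis
  proof (cases rule: points_cases)
    case (source s v)
    then obtain u x where u: "v = u @ [x]" by (auto elim: active_pairs_SucE)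
    obtain s' v' where "\<phi> (s, u) = (s', v')" by (cases "\<phi> (s, u)")
    then show ?thesis using source u by (simp add: extend_pair_def)
  next
    case (target s v)
    then obtain u x where u: "v = u @ [x]" "(s, u) \<in> active_pairs A i" by (auto elim: active_pairs_SucE)
    obtain s' v' where s': "\<phi> (s, u) = (s', v')" by (cases "\<phi> (s, u)")
    then show ?thesis using target u sec[OF u(2) s'] by (simp add: extend_pair_def)
  qed (use assms(2) in simp)
qed

text \<open>Tile reachability on level \<open>i + 1\<close> is \<open>transfer\<close> reachability
  between origins on level \<open>i\<close>; it is carried to level \<open>j\<close> there and read
  back on level \<open>j + 1\<close>. Apart from the information, only the next letter of
  \<open>w\<close> enters.\<close>

lemma info_hom_Suc:
  assumes \<phi>: "info_hom A w \<phi> i j" and w: "w i = w j"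
  shows "info_hom A w (extend_pair \<phi>) (Suc i) (Suc j)"
proof -
  have 1: "extend_pair \<phi> a \<in> active_pairs A (Suc j) \<and>
      case_prod (state_section A) (extend_pair \<phi> a) = case_prod (state_section A) a"
    if a: "a \<in> active_pairs A (Suc i)" for a
  proof -
    obtain s v x where v: "a = (s, v @ [x])" "(s, v) \<in> active_pairs A i" "x \<in> alphabet A"
      using a by (rule active_pairs_SucE)
    obtain s' v' where s': "\<phi> (s, v) = (s', v')" by (cases "\<phi> (s, v)")
    have "(s', v') \<in> active_pairs A j" "state_section A s' v' = state_section A s v"
      using \<phi> v(2) s' unfolding info_hom_def by fastforce+
    then show ?thesis using v a s'
      by (simp add: extend_pair_def active_pairs_snoc state_section_append)
  qed
  have "(vertex A w (Suc j) (map_point (extend_pair \<phi>) \<alpha>), vertex A w (Suc j) (map_point (extend_pair \<phi>) \<beta>))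
      \<in> (inert_rel A)\<^sup>*"
    if \<alpha>: "\<alpha> \<in> points A (Suc i)" and \<beta>: "\<beta> \<in> points A (Suc i)"
      and rel: "(vertex A w (Suc i) \<alpha>, vertex A w (Suc i) \<beta>) \<in> (inert_rel A)\<^sup>*" for \<alpha> \<beta>
  proof -
    have "(origin A w i \<alpha>, origin A w i \<beta>) \<in> (transfer A w (trivial_state A) i)\<^sup>*"
      using rel transfer_rtrancl_iff[of "trivial_state A" "fst (origin A w i \<alpha>)" i "snd (origin A w i \<alpha>)"
          "fst (origin A w i \<beta>)" "snd (origin A w i \<beta>)"] origin_props[OF \<alpha>] origin_props[OF \<beta>] by simp
    from info_hom_transfer[OF \<phi> this]
    have "(origin A w j (map_point (extend_pair \<phi>) \<alpha>), origin A w j (map_point (extend_pair \<phi>) \<beta>))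
        \<in> (transfer A w (trivial_state A) j)\<^sup>*"
      by (simp add: origin_hom[OF \<phi> w] \<alpha> \<beta>)
    moreover have "map_point (extend_pair \<phi>) \<alpha> \<in> points A (Suc j)" "map_point (extend_pair \<phi>) \<beta> \<in> points A (Suc j)"
      using \<alpha> \<beta> 1 by (auto elim!: points_cases)
    note origin_props[OF this(1)] origin_props[OF this(2)]
    ultimately show ?thesis
      using transfer_sound[of "fst (origin A w j (map_point (extend_pair \<phi>) \<alpha>))"
          "snd (origin A w j (map_point (extend_pair \<phi>) \<alpha>))"
          "fst (origin A w j (map_point (extend_pair \<phi>) \<beta>))"
          "snd (origin A w j (map_point (extend_pair \<phi>) \<beta>))" "trivial_state A" j]
      by simp
  qed
  then show ?thesis using 1 unfolding info_hom_def by blast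
qed

text \<open>Branching is reachability from the letter \<open>w i\<close> to another letter over the
  point \<open>None\<close>, for the \<open>transfer\<close> of the whole graph, so it is carried
  along by \<phi>.\<close>

lemma info_hom_branching:
  assumes \<phi>: "info_hom A w \<phi> i j" and w: "w i = w j" and "branching A w i"
  shows "branching A w j"
proof -
  obtain y where y: "y \<in> alphabet A" "y \<noteq> w i" "(prefix i w @ [w i], prefix i w @ [y]) \<in> (full_rel A)\<^sup>*"
    using assms(3) by (auto simp: branching_def)
  have "((None, w i), (None, y)) \<in> (transfer A w (\<lambda>_. True) i)\<^sup>*"
    using y transfer_rtrancl_iff[of "\<lambda>_. True" None i "w i" None y] by simp
  from info_hom_transfer[OF \<phi> this]
  have "((None, w j), (None, y)) \<in> (transfer A w (\<lambda>_. True) j)\<^sup>*" by (simp add: w)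
  then have "(prefix j w @ [w j], prefix j w @ [y]) \<in> (full_rel A)\<^sup>*"
    using transfer_sound[of None "w j" None y "\<lambda>_. True" j] by simp
  then show ?thesis using y w by (auto simp: branching_def)
qed

lemma info_hom_branching_add:
  assumes "info_hom A w \<phi> i j" and w: "\<And>t. w (i + t) = w (j + t)" and "branching A w (i + t)"
  shows "branching A w (j + t)"
proof -
  have "\<exists>\<phi>. info_hom A w \<phi> (i + t) (j + t)"
  proof (induction t)
    case (Suc t)
    then show ?case using info_hom_Suc w[of t] by (metis add_Suc_right)
  qed (use assms(1) in auto)
  then show ?thesis using info_hom_branching w assms(3) by blast
qed

text \<open>The numbering \<open>e\<close> replaces active pairs by numbers, which puts the
  information of all levels into one finite set.\<close>

definition info_code :: "('s \<times> 'x list \<Rightarrow> nat) \<Rightarrow> nat \<Rightarrow>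
  (nat \<times> 's) set \<times> ((nat \<times> bool) option \<times> (nat \<times> bool) option) set" where
  "info_code e i =
     ((\<lambda>a. (e a, case_prod (state_section A) a)) ` active_pairs A i,
      {(map_point e \<alpha>, map_point e \<beta>) | \<alpha> \<beta>. \<alpha> \<in> points A i \<and> \<beta> \<in> points A i \<and>
         (vertex A w i \<alpha>, vertex A w i \<beta>) \<in> (inert_rel A)\<^sup>*})"

text \<open>\<phi> sends an active pair to one with the same number and section. As \<open>f\<close>
  is injective, a coded point of level \<open>j\<close> has only one decoding, so the related pairs
  in the code of level \<open>j\<close> come from the images under \<phi>.\<close>

lemma info_hom_of_info_code_eq:
  assumes eq: "info_code e i = info_code f j" and inj: "inj_on f (active_pairs A j)"
  shows "\<exists>\<phi>. info_hom A w \<phi> i j"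
proof -
  have "\<forall>a \<in> active_pairs A i. \<exists>b. b \<in> active_pairs A j \<and> f b = e a \<and>
      case_prod (state_section A) b = case_prod (state_section A) a"
  proof
    fix a assume "a \<in> active_pairs A i"
    then have "(e a, case_prod (state_section A) a) \<in> fst (info_code f j)"
      unfolding eq[symmetric] by (auto simp: info_code_def)
    then obtain b where "(e a, case_prod (state_section A) a) = (f b, case_prod (state_section A) b)"
      "b \<in> active_pairs A j"
      unfolding info_code_def fst_conv by (rule imageE)
    then show "\<exists>b. b \<in> active_pairs A j \<and> f b = e a \<and>
      case_prod (state_section A) b = case_prod (state_section A) a"
      by (intro exI[of _ b] conjI) (simp_all only: prod.inject)
  qed
  from bchoice[OF this] obtain \<phi> where "\<forall>a \<in> active_pairs A i. \<phi> a \<in> active_pairs A j \<and> f (\<phi> a) = e a \<and>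
      case_prod (state_section A) (\<phi> a) = case_prod (state_section A) a" ..
  note \<phi> = bspec[OF this]
  have map: "map_point \<phi> \<alpha> \<in> points A j" "map_point f (map_point \<phi> \<alpha>) = map_point e \<alpha>" if "\<alpha> \<in> points A i" for \<alpha>
    using that by (cases rule: points_cases; simp add: \<phi>)+
  have inj': "\<alpha> = \<beta>" if *: "\<alpha> \<in> points A j" "\<beta> \<in> points A j" "map_point f \<alpha> = map_point f \<beta>" for \<alpha> \<beta>
  proof (cases \<alpha>)
    case None
    then show ?thesis using *(3) by simp
  next
    case (Some p)
    then obtain q where q: "\<beta> = Some q" using *(3) by (cases \<beta>) auto
    obtain a b a' b' where "p = (a, b)" "q = (a', b')" by (cases p, cases q)
    then show ?thesis using * Some q inj_onD[OF inj, of a a'] by simp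
  qed
  have "(vertex A w j (map_point \<phi> \<alpha>), vertex A w j (map_point \<phi> \<beta>)) \<in> (inert_rel A)\<^sup>*"
    if \<alpha>: "\<alpha> \<in> points A i" and \<beta>: "\<beta> \<in> points A i" and rel: "(vertex A w i \<alpha>, vertex A w i \<beta>) \<in> (inert_rel A)\<^sup>*" for \<alpha> \<beta>
  proof -
    have "(map_point e \<alpha>, map_point e \<beta>) \<in> snd (info_code f j)"
      unfolding eq[symmetric] unfolding info_code_def snd_conv mem_Collect_eq prod.inject
      using that by blast
    then obtain \<alpha>' \<beta>' where *: "map_point e \<alpha> = map_point f \<alpha>'" "map_point e \<beta> = map_point f \<beta>'"
      "\<alpha>' \<in> points A j" "\<beta>' \<in> points A j" "(vertex A w j \<alpha>', vertex A w j \<beta>') \<in> (inert_rel A)\<^sup>*"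
      unfolding info_code_def snd_conv mem_Collect_eq prod.inject by blast
    have "\<alpha>' = map_point \<phi> \<alpha>"
      by (rule inj'[OF *(3) map(1)[OF \<alpha>]]) (simp only: map(2)[OF \<alpha>] *(1))
    moreover have "\<beta>' = map_point \<phi> \<beta>"
      by (rule inj'[OF *(4) map(1)[OF \<beta>]]) (simp only: map(2)[OF \<beta>] *(2))
    ultimately show ?thesis using *(5) by (simp only:)
  qed
  then show ?thesis using \<phi> unfolding info_hom_def by blast
qed

end

text \<open>With at most \<open>b\<close> active pairs there are \<open>2 ^ (b * n)\<close> sets of
  numbered sections and \<open>2 ^ ((2 b + 1)^2)\<close> relations on the \<open>2 b + 1\<close>
  possible points.\<close>

definition info_bound :: "nat \<Rightarrow> nat \<Rightarrow> nat" where
  "info_bound k n = (let b = active_bound k n in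
     2 ^ (b * n) * 2 ^ (Suc (b * 2) * Suc (b * 2)))"

text \<open>Two levels with equal information and equal continuations of \<open>w\<close> have the
  same branching behaviour from there on; the pigeonhole principle provides them.\<close>

lemma branching_eventually_periodic:
  assumes A: "bounded_automaton A" and w: "range w \<subseteq> alphabet A"
    and per: "0 < p" "\<And>i. m \<le> i \<Longrightarrow> w (i + p) = w i"
  shows "\<exists>i d. 0 < d \<and> i + d \<le> m + p * info_bound (card (alphabet A)) (card (states A)) \<and>
    (\<forall>t \<ge> i. branching A w (t + d) \<longleftrightarrow> branching A w t)"
proof -
  let ?n = "card (states A)" and ?b = "active_bound (card (alphabet A)) (card (states A))"
  let ?K = "info_bound (card (alphabet A)) (card (states A))"
  have fin: "finite_automaton A" using A by (simp add: bounded_automaton_def)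
  then have fs: "finite (states A)" by (simp add: finite_automaton_def)
  interpret word_automaton A w using fin w by unfold_locales
  have "\<exists>e. inj_on e (active_pairs A i) \<and> e ` active_pairs A i \<subseteq> {..<?b}" for i
  proof -
    obtain e where "bij_betw e (active_pairs A i) {0..<card (active_pairs A i)}"
      using ex_bij_betw_finite_nat[OF finite_active_pairs[OF fin]] by blast
    then have "inj_on e (active_pairs A i)" "e ` active_pairs A i \<subseteq> {..<?b}"
      using card_active_pairs[OF A, of i] by (auto simp: bij_betw_def)
    then show ?thesis by blast
  qed
  then obtain e where e: "\<And>i. inj_on (e i) (active_pairs A i)" "\<And>i. e i ` active_pairs A i \<subseteq> {..<?b}"
    by metis
  let ?P = "insert None (Some ` ({..<?b} \<times> (UNIV :: bool set)))"
  define U where "U = Pow ({..<?b} \<times> states A) \<times> Pow (?P \<times> ?P)"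
  have code: "info_code (e i) i \<in> U" for i
  proof -
    have sec: "state_section A s v \<in> states A" if "(s, v) \<in> active_pairs A i" for s v
      using that state_section_in_states[OF fin] by (simp add: active_pairs_def)
    have "e i a < ?b" if "a \<in> active_pairs A i" for a
      using e(2)[of i] that by blast
    note bound = this
    have "map_point (e i) \<alpha> \<in> ?P" if \<alpha>: "\<alpha> \<in> points A i" for \<alpha>
      using \<alpha> by (cases \<alpha> rule: points_cases) (auto simp: bound)
    then show ?thesis using bound sec by (fastforce simp: info_code_def U_def)
  qed
  have "card ?P = Suc (?b * 2)"
    by (subst card_insert_disjoint) (auto simp: card_image card_cartesian_product)
  moreover have "finite (?P \<times> ?P)" "finite ({..<?b} \<times> states A)" using fs by auto
  ultimately have card: "card U = ?K"
    by (simp only: U_def card_cartesian_product card_Pow card_lessThan info_bound_def Let_def)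
  \<comment> \<open>Sampling past the preperiod in steps of \<open>p\<close> keeps the phase of
    \<open>w\<close>, so that a coincidence of codes comes with the same letters ahead. The
    \<open>?K + 1\<close> samples exceed the number \<open>?K\<close> of codes.\<close>
  define f where "f a = info_code (e (m + p * a)) (m + p * a)" for a
  have "f ` {..?K} \<subseteq> U" using code by (auto simp: f_def)
  moreover have "finite U" using fs by (simp add: U_def)
  ultimately have "\<not> inj_on f {..?K}"
    using card card_inj_on_le[of f "{..?K}" U] by fastforce
  then obtain a b where "a < b" "b \<le> ?K" "f a = f b"
    using linorder_inj_onI[of "{..?K}" f] by (metis atMost_iff linorder_le_cases)
  define i where "i = m + p * a"
  define j where "j = m + p * b"
  have ij: "i < j" "j \<le> m + p * ?K" using \<open>a < b\<close> \<open>b \<le> ?K\<close> per(1) by (auto simp: i_def j_def)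
  have "w (x + p * c) = w x" if "m \<le> x" for x c
  proof (induction c)
    case (Suc c)
    then show ?case using per(2)[of "x + p * c"] that by (simp add: add.assoc add.commute[of p])
  qed simp
  note w_mult = this
  have weq: "w (j + t) = w (i + t)" for t
  proof -
    have "p * b = p * a + p * (b - a)" using \<open>a < b\<close> by (simp add: distrib_left[symmetric])
    then have "j + t = i + t + p * (b - a)" by (simp add: i_def j_def)
    then show ?thesis by (simp only:) (rule w_mult, simp add: i_def)
  qed
  \<comment> \<open>The equality of codes is used both ways round, which turns the implication
    between branching levels into an equivalence.\<close>
  obtain \<phi> \<psi> where "info_hom A w \<phi> i j" "info_hom A w \<psi> j i"
    using info_hom_of_info_code_eq[of "e i" i "e j" j] info_hom_of_info_code_eq[of "e j" j "e i" i]
      e(1) \<open>f a = f b\<close> by (auto simp: f_def i_def j_def)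
  then have iff: "branching A w (j + t) \<longleftrightarrow> branching A w (i + t)" for t
    using info_hom_branching_add weq by metis
  have "branching A w (t + (j - i)) \<longleftrightarrow> branching A w t" if "i \<le> t" for t
    using iff[of "t - i"] that ij by (simp add: add.commute)
  then show ?thesis using ij by (intro exI[of _ i] exI[of _ "j - i"]) auto
qed

section \<open>Branching levels and orbits\<close>

lemma full_rel_iff: "(a, b) \<in> full_rel A \<longleftrightarrow> a \<in> words A \<and> (\<exists>s \<in> states A. b = state_output A s a)"
  by (auto simp: step_rel_def)

lemma full_rel_take:
  "(a, b) \<in> (full_rel A)\<^sup>* \<Longrightarrow> (take m a, take m b) \<in> (full_rel A)\<^sup>*"
proof (induction rule: rtrancl_induct)
  case (step b c)
  then obtain s where s: "s \<in> states A" "b \<in> words A" "c = state_output A s b"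
    by (auto simp: full_rel_iff)
  have "take m c = state_output A s (take m b)"
    using state_output_append[of A s "take m b" "drop m b"] s(3)
    by (metis append_eq_conv_conj append_take_drop_id length_state_output length_take take_all_iff min_def)
  moreover have "take m b \<in> words A" using s(2) by (auto simp: in_lists_conv_set dest: in_set_takeD)
  ultimately have "(take m b, take m c) \<in> full_rel A" using s(1) by (auto simp: full_rel_iff)
  then show ?case using step.IH by simp
qed simp

context word_automaton
begin

lemma full_rel_append:
  "(a, b) \<in> (full_rel A)\<^sup>* \<Longrightarrow> c \<in> words A \<Longrightarrow> \<exists>d \<in> words A. length d = length c \<and> (a @ c, b @ d) \<in> (full_rel A)\<^sup>*"
proof (induction rule: rtrancl_induct)
  case (step b b')
  then obtain d where d: "d \<in> words A" "length d = length c" "(a @ c, b @ d) \<in> (full_rel A)\<^sup>*" by blast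
  obtain s where s: "s \<in> states A" "b \<in> words A" "b' = state_output A s b"
    using step(2) by (auto simp: full_rel_iff)
  let ?d = "state_output A (state_section A s b) d"
  have "(b @ d, b' @ ?d) \<in> full_rel A"
    using s d by (auto simp: full_rel_iff state_output_append)
  moreover have "?d \<in> words A"
    by (intro state_output_in_words state_section_in_states finite_automaton s d)
  ultimately show ?case using d by (intro bexI[of _ ?d]) auto
qed auto

lemma take_prefix: "m \<le> n \<Longrightarrow> take m (prefix n w) = prefix m w"
  by simp

text \<open>A branching step at level \<open>l\<close> lifts to words of length \<open>m\<close> by
  letting the path act on the remaining letters. Conversely, the first position at which
  \<open>z\<close> leaves \<open>w\<close> is a branching level, as truncating the path just after
  it shows.\<close>

lemma branching_iff_exists:
  assumes "i \<le> m"
  shows "(\<exists>l \<in> {i..<m}. branching A w l) \<longleftrightarrow>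
    (\<exists>z. (prefix m w, z) \<in> (full_rel A)\<^sup>* \<and> take i z = prefix i w \<and> z \<noteq> prefix m w)"
proof
  assume "\<exists>l \<in> {i..<m}. branching A w l"
  then obtain l y where l: "i \<le> l" "l < m" and y: "y \<noteq> w l" "(prefix (Suc l) w, prefix l w @ [y]) \<in> (full_rel A)\<^sup>*"
    by (auto simp: branching_def)
  define c where "c = drop (Suc l) (prefix m w)"
  have split: "prefix (Suc l) w @ c = prefix m w"
    using take_prefix[of "Suc l" m] l(2) append_take_drop_id[of "Suc l" "prefix m w"] by (simp only: c_def Suc_le_eq)
  have "c \<in> words A" unfolding c_def using prefix_in_words[of m] by (auto simp: in_lists_conv_set dest: in_set_dropD simp del: prefix_in_words)
  from full_rel_append[OF y(2) this, unfolded split] obtain d where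
    d: "(prefix m w, prefix l w @ [y] @ d) \<in> (full_rel A)\<^sup>*"
    by auto
  have "prefix l w @ [y] @ d \<noteq> prefix m w"
  proof
    assume "prefix l w @ [y] @ d = prefix m w"
    then have "(prefix l w @ [y] @ d) ! l = prefix m w ! l" by simp
    then show False using y l by (simp add: nth_append)
  qed
  then show "\<exists>z. (prefix m w, z) \<in> (full_rel A)\<^sup>* \<and> take i z = prefix i w \<and> z \<noteq> prefix m w"
    using d l by (intro exI[of _ "prefix l w @ [y] @ d"]) simp
next
  assume "\<exists>z. (prefix m w, z) \<in> (full_rel A)\<^sup>* \<and> take i z = prefix i w \<and> z \<noteq> prefix m w"
  then obtain z where z: "(prefix m w, z) \<in> (full_rel A)\<^sup>*" "take i z = prefix i w" "z \<noteq> prefix m w"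
    by blast
  have zw: "z \<in> words A" "length z = m" using step_rel_closed[OF z(1)] by auto
  define l where "l = (LEAST l. l < m \<and> z ! l \<noteq> w l)"
  have ex: "\<exists>l. l < m \<and> z ! l \<noteq> w l"
  proof (rule ccontr)
    assume "\<not> ?thesis"
    then have "z = prefix m w" using zw by (intro nth_equalityI) auto
    then show False using z(3) by simp
  qed
  have l: "l < m" "z ! l \<noteq> w l" using LeastI_ex[OF ex] by (auto simp: l_def)
  have least: "z ! j = w j" if "j < l" for j
    using not_less_Least[of j "\<lambda>l. l < m \<and> z ! l \<noteq> w l"] that l by (auto simp: l_def)
  have "i \<le> l"
  proof (rule ccontr)
    assume "\<not> i \<le> l"
    then have "z ! l = take i z ! l" by simp
    also have "\<dots> = w l" using \<open>\<not> i \<le> l\<close> by (simp add: z(2))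
    finally show False using l by simp
  qed
  have "take l z = prefix l w" using least l zw by (intro nth_equalityI) auto
  then have "take (Suc l) z = prefix l w @ [z ! l]" using l zw by (simp add: take_Suc_conv_app_nth)
  moreover have "z ! l \<in> alphabet A" using zw l by (auto simp: in_lists_conv_set)
  ultimately have "branching A w l"
    using full_rel_take[OF z(1), of "Suc l"] take_prefix[of "Suc l" m] l unfolding branching_def
    by (intro bexI[of _ "z ! l"]) auto
  then show "\<exists>l \<in> {i..<m}. branching A w l" using l \<open>i \<le> l\<close> by auto
qed

end

text \<open>Powers of a permutation of the finite set of words of a given length realise its inverse.\<close>

lemma full_rel_inverse:
  assumes fin: "finite_automaton A" and inv: "invertible_automaton A"
    and s: "s \<in> states A" and y: "y \<in> words A"
  shows "(state_output A s y, y) \<in> (full_rel A)\<^sup>*"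
proof -
  let ?f = "state_output A s"
  \<comment> \<open>\<open>R\<close> collects the words reachable from \<open>?f y\<close>. It is
    finite and mapped into itself by the injective \<open>?f\<close>, hence onto itself, so the
    preimage \<open>y\<close> of \<open>?f y\<close> belongs to \<open>R\<close>.\<close>
  define R where "R = {z. (?f y, z) \<in> (full_rel A)\<^sup>*} \<inter> {z \<in> words A. length z = length y}"
  have inj: "inj_on ?f (words A)"
    using inv s unfolding invertible_automaton_def transformation_def bij_betw_def
    by (metis inj_on_restrict_eq)
  have "finite R" unfolding R_def using fin by (simp add: finite_automaton_def finite_words_length)
  moreover have "?f ` R \<subseteq> R"
  proof (rule image_subsetI)
    fix z assume z: "z \<in> R"
    then have "(z, ?f z) \<in> full_rel A" using s by (auto simp: full_rel_iff R_def)
    then show "?f z \<in> R" using z state_output_in_words[OF fin s] by (auto simp: R_def)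
  qed
  moreover have "inj_on ?f R" using inj by (rule inj_on_subset) (auto simp: R_def)
  ultimately have "?f ` R = R" by (rule endo_inj_surj)
  moreover have "?f y \<in> R" using state_output_in_words[OF fin s y] by (simp add: R_def)
  ultimately obtain z where z: "z \<in> R" "?f y = ?f z" by blast
  then have "y = z" using inj y by (auto simp: R_def inj_on_def)
  then show ?thesis using z by (simp add: R_def)
qed

section \<open>The group action as reachability along forward edges\<close>

lemma automaton_group_mult:
  assumes "invertible_automaton A" "g \<in> carrier (automaton_group A)" "h \<in> carrier (automaton_group A)"
  shows "g \<otimes>\<^bsub>automaton_group A\<^esub> h = compose (words A) g h"
    "g \<in> Bij (words A)"
proof -
  have "transformation A ` states A \<subseteq> carrier (BijGroup (words A))"
    using assms by (auto simp: invertible_automaton_def BijGroup_def Bij_def transformation_def)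
  from group.generate_incl[OF group_BijGroup this]
  have "carrier (automaton_group A) \<subseteq> carrier (BijGroup (words A))" by (simp add: automaton_group_def)
  then have "carrier (automaton_group A) \<subseteq> Bij (words A)" by (simp add: BijGroup_def)
  then show "g \<otimes>\<^bsub>automaton_group A\<^esub> h = compose (words A) g h" "g \<in> Bij (words A)"
    using assms by (auto simp: automaton_group_def BijGroup_def)
qed

text \<open>All properties pass to products. For the inverse of a generator, compatibility with
  prefixes follows from injectivity of the generator, and reachability from
  \<open>full_rel_inverse\<close>.\<close>

lemma automaton_group_full_rel:
  assumes fin: "finite_automaton A" and inv: "invertible_automaton A"
    and g: "g \<in> carrier (automaton_group A)"
  shows "g \<in> words A \<rightarrow> words A \<and> (\<forall>x \<in> words A. length (g x) = length x \<and> (\<forall>m. g (take m x) = take m (g x)) \<and>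
     (x, g x) \<in> (full_rel A)\<^sup>*)"
proof -
  have tk: "take m x \<in> words A" if "x \<in> words A" for x :: "'b list" and m
    using that by (auto simp: in_lists_conv_set dest: in_set_takeD)
  have out: "state_output A s (take m x) = take m (state_output A s x)" for s m x
    using state_output_append[of A s "take m x" "drop m x"]
    by (metis append_eq_conv_conj append_take_drop_id length_state_output length_take take_all_iff min_def)
  have bij: "transformation A s \<in> Bij (words A)" if "s \<in> states A" for s
    using that inv by (auto simp: invertible_automaton_def Bij_def transformation_def)
  have "g \<in> generate (BijGroup (words A)) (transformation A ` states A)"
    using g by (simp add: automaton_group_def)
  then show ?thesis
  proof (induction rule: generate.induct)
    case one
    then show ?case using tk by (simp add: BijGroup_def)
  next
    case (incl h)
    then obtain s where s: "s \<in> states A" "h = transformation A s" by blast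
    have "(x, state_output A s x) \<in> (full_rel A)\<^sup>*" if "x \<in> words A" for x
      using s(1) that by (intro r_into_rtrancl) (auto simp: full_rel_iff)
    then show ?case
      using state_output_in_words[OF fin s(1)] tk out s
      by (auto simp: transformation_def simp del: in_lists_conv_set)
  next
    case (inv h)
    then obtain s where s: "s \<in> states A" "h = transformation A s" by blast
    let ?i = "inv_into (words A) (transformation A s)"
    have eq: "inv\<^bsub>BijGroup (words A)\<^esub> h = restrict ?i (words A)"
      using inv_BijGroup[OF bij[OF s(1)]] s by simp
    have bb: "bij_betw (transformation A s) (words A) (words A)" using bij[OF s(1)] by (simp add: Bij_def)
    have *: "?i x \<in> words A" "state_output A s (?i x) = x" if "x \<in> words A" for x
    proof -
      show 1: "?i x \<in> words A" using bb that by (metis bij_betw_def inv_into_into)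
      have "transformation A s (?i x) = x" using bb that by (metis bij_betw_inv_into_right)
      then show "state_output A s (?i x) = x" using 1 by (simp add: transformation_def)
    qed
    have inj: "x = y" if "x \<in> words A" "y \<in> words A" "state_output A s x = state_output A s y" for x y
      using bb that unfolding bij_betw_def inj_on_def by (simp add: transformation_def)
    have len: "length (?i x) = length x" if "x \<in> words A" for x
      using *(2)[OF that] length_state_output by metis
    have "?i (take m x) = take m (?i x)" if "x \<in> words A" for x m
    proof (rule inj)
      show "state_output A s (?i (take m x)) = state_output A s (take m (?i x))"
        using * that tk by (simp add: out)
    qed (use * tk that in auto)
    moreover have "(x, ?i x) \<in> (full_rel A)\<^sup>*" if "x \<in> words A" for x
      using full_rel_inverse[OF fin assms(2) s(1) *(1)[OF that]] *(2)[OF that] by simp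
    ultimately show ?case unfolding eq using * len tk by (simp add: Pi_iff)
  next
    case (eng h1 h2)
    have "h1 \<in> Bij (words A)" "h2 \<in> Bij (words A)"
      using automaton_group_mult(2)[OF assms(2)] eng(1,2) by (simp_all add: automaton_group_def)
    then have eq: "h1 \<otimes>\<^bsub>BijGroup (words A)\<^esub> h2 = compose (words A) h1 h2"
      by (simp add: BijGroup_def)
    have h2: "h2 x \<in> words A" if "x \<in> words A" for x using eng.IH(2) that by blast
    have h1: "h1 x \<in> words A" if "x \<in> words A" for x using eng.IH(1) that by blast
    have "(x, h1 (h2 x)) \<in> (full_rel A)\<^sup>*" if "x \<in> words A" for x
      using eng.IH that h2[OF that] by (blast intro: rtrancl_trans)
    then show ?case unfolding eq
      using eng.IH h1 h2 tk by (simp add: compose_def Pi_iff)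
  qed
qed

text \<open>Prolonging a path by an edge multiplies the group element on the left by the
  transformation of the state read there.\<close>

lemma full_rel_automaton_group:
  assumes fin: "finite_automaton A" and inv: "invertible_automaton A"
    and "(a, b) \<in> (full_rel A)\<^sup>*" and a: "a \<in> words A"
  shows "\<exists>g \<in> carrier (automaton_group A). g a = b"
  using assms(3)
proof (induction rule: rtrancl_induct)
  case base
  have "\<one>\<^bsub>automaton_group A\<^esub> \<in> carrier (automaton_group A)"
    using group_automaton_group[OF inv] by (simp add: group.is_monoid)
  moreover have "\<one>\<^bsub>automaton_group A\<^esub> a = a" using a by (simp add: automaton_group_def BijGroup_def)
  ultimately show ?case by blast
next
  case (step b c)
  then obtain g where g: "g \<in> carrier (automaton_group A)" "g a = b" by blast
  obtain s where s: "s \<in> states A" "b \<in> words A" "c = state_output A s b"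
    using step(2) by (auto simp: full_rel_iff)
  have "transformation A s \<in> carrier (automaton_group A)"
    using s by (simp add: automaton_group_def generate.incl)
  moreover from this g have "transformation A s \<otimes>\<^bsub>automaton_group A\<^esub> g \<in> carrier (automaton_group A)"
    using group_automaton_group[OF inv] by (simp add: group.subgroup_self monoid.m_closed group.is_monoid)
  ultimately show ?case
    using g s a automaton_group_mult(1)[OF inv, of "transformation A s" g]
    by (intro bexI[of _ "transformation A s \<otimes>\<^bsub>automaton_group A\<^esub> g"]) (auto simp: compose_def transformation_def)
qed

section \<open>Orbits of infinite words\<close>

lemma prefix_omega_action:
  assumes fin: "finite_automaton A" and inv: "invertible_automaton A" and w: "range w \<subseteq> alphabet A"
    and g: "g \<in> carrier (automaton_group A)"
  shows "prefix n (omega_action g w) = g (prefix n w)"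
proof -
  interpret word_automaton A w using fin w by unfold_locales
  note g' = automaton_group_full_rel[OF fin inv g]
  show ?thesis
  proof (rule nth_equalityI)
    show "length (prefix n (omega_action g w)) = length (g (prefix n w))" using g' by simp
    fix i assume "i < length (prefix n (omega_action g w))"
    then have i: "i < n" by simp
    then have "g (prefix (Suc i) w) = take (Suc i) (g (prefix n w))"
      using g' take_prefix[of "Suc i" n] by (metis Suc_leI prefix_in_words)
    then show "prefix n (omega_action g w) ! i = g (prefix n w) ! i"
      using i by (simp add: omega_action_def)
  qed
qed

lemma prefix_eqI: "(\<And>n. prefix n x = prefix n y) \<Longrightarrow> x = y"
proof
  fix i assume "\<And>n. prefix n x = prefix n y"
  then have "prefix (Suc i) x ! i = prefix (Suc i) y ! i" by simp
  then show "x i = y i" by (simp del: subseq_to_Suc)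
qed

text \<open>A branching level \<open>i\<close> yields an orbit point that leaves \<open>w\<close>
  exactly at position \<open>i\<close>, so distinct levels yield distinct points. Conversely, a
  prefix whose length exceeds all branching levels determines the orbit point, and there are
  finitely many such prefixes.\<close>

lemma finite_orbit_iff:
  assumes fin: "finite_automaton A" and inv: "invertible_automaton A" and w: "range w \<subseteq> alphabet A"
  shows "finite (orbit (automaton_group A) omega_action w) \<longleftrightarrow> finite {i. branching A w i}"
proof -
  interpret word_automaton A w using fin w by unfold_locales
  interpret G: group "automaton_group A" by (rule group_automaton_group[OF inv])
  note grp = automaton_group_full_rel[OF fin inv]
  note pre = prefix_omega_action[OF fin inv w]
  let ?O = "orbit (automaton_group A) omega_action w"
  show ?thesis
  proof
    assume "finite ?O"
    have "\<exists>x \<in> ?O. prefix i x = prefix i w \<and> x i \<noteq> w i" if "branching A w i" for i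
    proof -
      obtain y where y: "y \<noteq> w i" "(prefix (Suc i) w, prefix i w @ [y]) \<in> (full_rel A)\<^sup>*"
        using \<open>branching A w i\<close> by (auto simp: branching_def)
      obtain g where g: "g \<in> carrier (automaton_group A)" "g (prefix (Suc i) w) = prefix i w @ [y]"
        using full_rel_automaton_group[OF fin inv y(2) prefix_in_words] by blast
      let ?x = "omega_action g w"
      have "prefix i ?x @ [?x i] = prefix i w @ [y]" using pre[OF g(1), of "Suc i"] g(2) by simp
      then show ?thesis using g y by (intro bexI[of _ ?x]) (auto simp: orbit_def)
    qed
    then obtain x where x: "\<And>i. branching A w i \<Longrightarrow> x i \<in> ?O \<and> prefix i (x i) = prefix i w \<and> x i i \<noteq> w i"
      by metis
    have "inj_on x {i. branching A w i}"
    proof (rule linorder_inj_onI)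
      fix i j assume ij: "i < j" "i \<in> {i. branching A w i}" "j \<in> {i. branching A w i}"
      then have "prefix j (x j) ! i = prefix j w ! i" using x[of j] by simp
      then have "x j i = w i" using ij by simp
      then show "x i \<noteq> x j" using x[of i] ij by auto
    qed auto
    moreover have "x ` {i. branching A w i} \<subseteq> ?O" using x by auto
    ultimately show "finite {i. branching A w i}" using \<open>finite ?O\<close> inj_on_finite by blast
  next
    assume "finite {i. branching A w i}"
    then obtain n where n: "\<And>i. branching A w i \<Longrightarrow> i < n"
      using finite_nat_set_iff_bounded by auto
    have "inj_on (prefix n) ?O"
    proof (rule inj_onI)
      fix x y assume "x \<in> ?O" "y \<in> ?O" and eq: "prefix n x = prefix n y"
      then obtain g h where g: "g \<in> carrier (automaton_group A)" "x = omega_action g w"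
        and h: "h \<in> carrier (automaton_group A)" "y = omega_action h w"
        by (auto simp: orbit_def)
      \<comment> \<open>The quotient of \<open>h\<close> and \<open>g\<close> fixes the prefix of
        \<open>w\<close> of length \<open>n\<close>; without branching from level \<open>n\<close>
        on it must fix all longer prefixes as well, whence \<open>g\<close> and \<open>h\<close>
        agree on \<open>w\<close>.\<close>
      define f where "f = inv\<^bsub>automaton_group A\<^esub> h \<otimes>\<^bsub>automaton_group A\<^esub> g"
      have f: "f \<in> carrier (automaton_group A)" using g h by (simp add: f_def)
      have "h \<otimes>\<^bsub>automaton_group A\<^esub> f = g" using g h by (simp add: f_def G.m_assoc[symmetric])
      then have hf: "g z = h (f z)" if "z \<in> words A" for z
        using automaton_group_mult(1)[OF inv h(1) f] that by (auto simp: compose_def)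
      have inj: "inj_on h (words A)"
        using automaton_group_mult(2)[OF inv h(1) h(1)] by (simp add: Bij_def bij_betw_def)
      have "h (f (prefix n w)) = h (prefix n w)"
        using eq hf[OF prefix_in_words, of n] pre[OF g(1), of n] pre[OF h(1), of n] g(2) h(2) by simp
      moreover have "f (prefix n w) \<in> words A" using grp[OF f] prefix_in_words by blast
      ultimately have "f (prefix n w) = prefix n w"
        by (rule inj_onD[OF inj _ _ prefix_in_words])
      have fix_all: "f (prefix m w) = prefix m w" for m
      proof (cases "n \<le> m")
        case False
        then have "prefix m w = take m (prefix n w)" by simp
        then show ?thesis using grp[OF f] \<open>f (prefix n w) = prefix n w\<close> prefix_in_words by metis
      next
        case True
        have "\<not> (\<exists>l \<in> {n..<m}. branching A w l)" using n by force
        moreover have "take n (f (prefix m w)) = prefix n w"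
          using grp[OF f] \<open>f (prefix n w) = prefix n w\<close> prefix_in_words take_prefix[OF True] by metis
        moreover have "(prefix m w, f (prefix m w)) \<in> (full_rel A)\<^sup>*"
          using grp[OF f] prefix_in_words by blast
        ultimately show ?thesis using branching_iff_exists[OF True] by blast
      qed
      show "x = y"
      proof (rule prefix_eqI)
        fix m show "prefix m x = prefix m y"
          using pre[OF g(1)] pre[OF h(1)] hf[OF prefix_in_words] fix_all g h by simp
      qed
    qed
    moreover have "prefix n ` ?O \<subseteq> {v \<in> words A. length v = n}"
    proof (rule image_subsetI)
      fix x assume "x \<in> ?O"
      then obtain g where g: "g \<in> carrier (automaton_group A)" "x = omega_action g w"
        by (auto simp: orbit_def)
      then have "g (prefix n w) \<in> words A" using grp[OF g(1)] prefix_in_words by blast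
      then have "prefix n x \<in> words A" using pre[OF g(1), of n] g(2) by (simp only:)
      then show "prefix n x \<in> {v \<in> words A. length v = n}" by simp
    qed
    moreover have "finite {v \<in> words A. length v = n}"
      using fin by (simp add: finite_automaton_def finite_words_length)
    ultimately show "finite ?O" by (rule inj_on_finite)
  qed
qed

text \<open>The window from \<open>N\<close> to \<open>2 N\<close> starts behind the preperiod of
  the set of branching levels and contains a full period, so it meets this set iff the set is
  infinite.\<close>

lemma finite_orbit_iff_bounded:
  assumes A: "bounded_automaton A" and w: "range w \<subseteq> alphabet A"
    and per: "0 < p" "\<And>i. m \<le> i \<Longrightarrow> w (i + p) = w i"
    and N: "m + p * info_bound (card (alphabet A)) (card (states A)) \<le> N"
  shows "finite (orbit (automaton_group A) omega_action w) \<longleftrightarrow>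
    \<not> (\<exists>z. (prefix (2 * N) w, z) \<in> (full_rel A)\<^sup>* \<and> take N z = prefix N w \<and> z \<noteq> prefix (2 * N) w)"
proof -
  have fin: "finite_automaton A" "invertible_automaton A" using A by (auto simp: bounded_automaton_def)
  interpret word_automaton A w using fin(1) w by unfold_locales
  obtain i d where d': "0 < d" "i + d \<le> m + p * info_bound (card (alphabet A)) (card (states A))"
    and d'': "\<forall>t \<ge> i. branching A w (t + d) \<longleftrightarrow> branching A w t"
    using branching_eventually_periodic[of A w p m, OF A w per] by blast
  have d: "0 < d" "i + d \<le> N" "\<And>t. i \<le> t \<Longrightarrow> branching A w (t + d) \<longleftrightarrow> branching A w t"
    using d' N d'' by simp_all
  have mult: "branching A w (t + c * d) \<longleftrightarrow> branching A w t" if "i \<le> t" for t c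
  proof (induction c)
    case (Suc c)
    then show ?case using d(3)[of "t + c * d"] that by (simp add: add.assoc add.commute[of d])
  qed simp
  have "finite {t. branching A w t} \<longleftrightarrow> \<not> (\<exists>l \<in> {N..<2 * N}. branching A w l)"
  proof
    assume finite: "finite {t. branching A w t}"
    show "\<not> (\<exists>l \<in> {N..<2 * N}. branching A w l)"
    proof
      assume "\<exists>l \<in> {N..<2 * N}. branching A w l"
      then obtain l where l: "N \<le> l" "branching A w l" by auto
      have "range (\<lambda>c. l + c * d) \<subseteq> {t. branching A w t}"
        using mult[of l] l d(2) by (intro image_subsetI) simp
      moreover have "inj (\<lambda>c. l + c * d)" using d(1) by (simp add: inj_def)
      ultimately show False using finite_subset[OF _ finite] range_inj_infinite by metis
    qed
  next
    assume no: "\<not> (\<exists>l \<in> {N..<2 * N}. branching A w l)"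
    have "t < N" if "branching A w t" for t
    proof (rule ccontr)
      assume "\<not> t < N"
      \<comment> \<open>The level \<open>t\<close> is moved back by multiples of the period
        \<open>d\<close> into \<open>[N, N + d)\<close>, which lies in the window since
        \<open>d \<le> N\<close>.\<close>
      let ?l = "N + (t - N) mod d"
      have "?l + (t - N) div d * d = t" using \<open>\<not> t < N\<close> by simp
      moreover have "i \<le> ?l" using d(2) by simp
      ultimately have "branching A w ?l" using mult[of ?l "(t - N) div d"] that by (simp only:)
      moreover have "?l < 2 * N" using mod_less_divisor[OF d(1), of "t - N"] d(2) by linarith
      ultimately show False using no by auto
    qed
    then show "finite {t. branching A w t}" using finite_nat_set_iff_bounded by blast
  qed
  moreover have "N \<le> 2 * N" by simp
  ultimately show ?thesis unfolding finite_orbit_iff[OF fin w] by (simp only: branching_iff_exists)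
qed

section \<open>Computable functions\<close>

text \<open>
  The arguments of a function are read off an environment \<open>e\<close>, so that the variables of a recursion step
  are shifted by beta-reduction.
\<close>

definition computable :: "nat \<Rightarrow> ((nat \<Rightarrow> nat) \<Rightarrow> nat) \<Rightarrow> bool" where
  "computable m f \<longleftrightarrow> (\<exists>p. \<forall>xs. length xs = m \<longrightarrow> evals p xs (f ((!) xs)))"

definition decidable :: "nat \<Rightarrow> ((nat \<Rightarrow> nat) \<Rightarrow> bool) \<Rightarrow> bool" where
  "decidable m P \<longleftrightarrow> computable m (\<lambda>e. if P e then 1 else 0)"

named_theorems computable_intros

section \<open>Closure properties of computable functions\<close>

lemma computable_var [computable_intros]: "i < m \<Longrightarrow> computable m (\<lambda>e. e i)"
  unfolding computable_def by (auto intro!: exI[of _ "Proj i"] evals_Proj)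

lemma computable_Suc [computable_intros]:
  assumes "computable m f"
  shows "computable m (\<lambda>e. Suc (f e))"
proof -
  obtain p where p: "\<And>xs. length xs = m \<Longrightarrow> evals p xs (f ((!) xs))"
    using assms by (auto simp: computable_def)
  have "evals (Comp Succ [p]) xs (Suc (f ((!) xs)))" if "length xs = m" for xs
    using p[OF that] by (intro evals_Comp[of xs _ "[f ((!) xs)]"]) (auto intro: evals_Succ)
  then show ?thesis unfolding computable_def by blast
qed

lemma computable_const [computable_intros]: "computable m (\<lambda>_. c)"
proof (induction c)
  case 0
  show ?case unfolding computable_def by (auto intro!: exI[of _ Zero] evals_Zero)
qed (rule computable_Suc)

text \<open>\<open>PrimRec\<close> puts the counter and the previous value in front of the
  arguments, so in the step function the parameters sit two places further on.\<close>

lemma computable_rec [computable_intros]: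
  assumes "computable m f" "computable (Suc (Suc m)) (\<lambda>e. g (e 0) (e (Suc 0)) (\<lambda>i. e (Suc (Suc i))))"
    and "computable m h"
  shows "computable m (\<lambda>e. rec_nat (f e) (\<lambda>i r. g i r e) (h e))"
proof -
  obtain pf pg ph where pf: "\<And>xs. length xs = m \<Longrightarrow> evals pf xs (f ((!) xs))"
    and pg: "\<And>xs. length xs = Suc (Suc m) \<Longrightarrow> evals pg xs (g (xs ! 0) (xs ! Suc 0) (\<lambda>i. xs ! Suc (Suc i)))"
    and ph: "\<And>xs. length xs = m \<Longrightarrow> evals ph xs (h ((!) xs))"
    using assms unfolding computable_def by blast
  have rec: "evals (PrimRec pf pg) (n # xs) (rec_nat (f ((!) xs)) (\<lambda>i r. g i r ((!) xs)) n)"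
    if "length xs = m" for n xs
  proof (induction n)
    case 0
    then show ?case using pf[OF that] by (simp add: evals_PrimRec_0)
  next
    case (Suc n)
    let ?r = "rec_nat (f ((!) xs)) (\<lambda>i r. g i r ((!) xs)) n"
    have "evals pg (n # ?r # xs) (g n ?r ((!) xs))" using pg[of "n # ?r # xs"] that by simp
    then show ?case using evals_PrimRec_Suc[OF Suc.IH] by simp
  qed
  have "evals (Comp (PrimRec pf pg) (ph # map Proj [0..<m])) xs
      (rec_nat (f ((!) xs)) (\<lambda>i r. g i r ((!) xs)) (h ((!) xs)))" if "length xs = m" for xs
  proof (rule evals_Comp)
    show "list_all2 (\<lambda>p. evals p xs) (ph # map Proj [0..<m]) (h ((!) xs) # xs)"
      using that by (simp add: ph, auto simp: list_all2_conv_all_nth intro!: evals_Proj)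
  qed (rule rec[OF that])
  then show ?thesis unfolding computable_def by blast
qed

lemma computable_add [computable_intros]:
  assumes "computable m f" "computable m g"
  shows "computable m (\<lambda>e. f e + g e)"
proof -
  have rec: "a + b = rec_nat b (\<lambda>_ r. Suc r) a" for a b :: nat by (induction a) auto
  show ?thesis unfolding rec by (intro computable_intros assms) simp_all
qed

text \<open>Weakening: a function of the parameters remains available inside a recursion step, where
  two variables precede them.\<close>

lemma computable_shift:
  assumes "computable m f"
  shows "computable (Suc (Suc m)) (\<lambda>e. f (\<lambda>i. e (Suc (Suc i))))"
proof -
  obtain p where p: "\<And>xs. length xs = m \<Longrightarrow> evals p xs (f ((!) xs))"
    using assms by (auto simp: computable_def)
  have "evals (Comp p (map (\<lambda>i. Proj (Suc (Suc i))) [0..<m])) xs (f (\<lambda>i. xs ! Suc (Suc i)))"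
    if len: "length xs = Suc (Suc m)" for xs
  proof -
    obtain x y ys where xs: "xs = x # y # ys" using len by (auto simp: length_Suc_conv)
    have "list_all2 (\<lambda>p. evals p xs) (map (\<lambda>i. Proj (Suc (Suc i))) [0..<m]) ys"
      unfolding list_all2_conv_all_nth
    proof (intro conjI allI impI)
      fix i assume i: "i < length (map (\<lambda>i. Proj (Suc (Suc i))) [0..<m])"
      then show "evals (map (\<lambda>i. Proj (Suc (Suc i))) [0..<m] ! i) xs (ys ! i)"
        using evals_Proj[of "Suc (Suc i)" xs] len xs by simp
    qed (use len xs in simp)
    moreover have "evals p ys (f (\<lambda>i. xs ! Suc (Suc i)))" using p[of ys] len xs by simp
    ultimately show ?thesis by (rule evals_Comp)
  qed
  then show ?thesis unfolding computable_def by blast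
qed

lemma computable_mult [computable_intros]:
  assumes "computable m f" "computable m g"
  shows "computable m (\<lambda>e. f e * g e)"
proof -
  have rec: "a * b = rec_nat 0 (\<lambda>_ r. b + r) a" for a b :: nat by (induction a) auto
  show ?thesis unfolding rec by (intro computable_intros computable_shift assms) simp_all
qed

lemma computable_diff [computable_intros]:
  assumes "computable m f" "computable m g"
  shows "computable m (\<lambda>e. f e - g e)"
proof -
  have pred: "a - 1 = rec_nat 0 (\<lambda>i _. i) a" for a :: nat by (induction a) auto
  have rec: "a - b = rec_nat a (\<lambda>_ r. rec_nat 0 (\<lambda>i _. i) r) b" for a b :: nat
    unfolding pred[symmetric] by (induction b) auto
  show ?thesis unfolding rec by (intro computable_intros assms) simp_all
qed

lemma computable_power [computable_intros]:
  assumes "computable m f" "computable m g"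
  shows "computable m (\<lambda>e. f e ^ g e)"
proof -
  have rec: "a ^ b = rec_nat 1 (\<lambda>_ r. a * r) b" for a b :: nat by (induction b) auto
  show ?thesis unfolding rec by (intro computable_intros computable_shift assms) simp_all
qed

lemma computable_if [computable_intros]:
  assumes "decidable m P" "computable m f" "computable m g"
  shows "computable m (\<lambda>e. if P e then f e else g e)"
proof -
  have rec: "(\<lambda>e. if P e then f e else g e) =
      (\<lambda>e. rec_nat (g e) (\<lambda>_ _. f e) (if P e then 1 else 0))"
    by auto
  show ?thesis unfolding rec
    by (intro computable_rec computable_shift assms assms(1)[unfolded decidable_def])
qed

lemma decidable_less [computable_intros]:
  assumes "computable m f" "computable m g"
  shows "decidable m (\<lambda>e. f e < g e)"
proof -
  have "(\<lambda>e. if f e < g e then 1 else 0) = (\<lambda>e. 1 - (1 - (g e - f e)))" by auto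
  then show ?thesis unfolding decidable_def by (simp only:) (intro computable_intros assms)
qed

lemma decidable_not [computable_intros]:
  assumes "decidable m P"
  shows "decidable m (\<lambda>e. \<not> P e)"
proof -
  have "(\<lambda>e. if \<not> P e then 1 else 0) = (\<lambda>e. 1 - (if P e then 1 else (0::nat)))" by auto
  then show ?thesis unfolding decidable_def by (simp only:) (intro computable_intros assms)
qed

lemma decidable_conj [computable_intros]:
  assumes "decidable m P" "decidable m Q"
  shows "decidable m (\<lambda>e. P e \<and> Q e)"
proof -
  have "(\<lambda>e. if P e \<and> Q e then 1 else 0) = (\<lambda>e. if P e then if Q e then 1 else 0 else (0::nat))" by auto
  then show ?thesis unfolding decidable_def by (simp only:) (intro computable_intros assms)
qed

lemma decidable_eq [computable_intros]:
  assumes "computable m f" "computable m g"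
  shows "decidable m (\<lambda>e. f e = g e)"
proof -
  have "(\<lambda>e. f e = g e) = (\<lambda>e. \<not> f e < g e \<and> \<not> g e < f e)" by auto
  then show ?thesis by (simp only:) (intro computable_intros assms)
qed

text \<open>The search is a recursion whose result switches to 1 at a witness; place 1 of the
  environment holds the accumulated result, hence the shift by two.\<close>

lemma decidable_bex [computable_intros]:
  assumes "decidable (Suc (Suc m)) (\<lambda>e. P (e 0) (\<lambda>i. e (Suc (Suc i))))" "computable m h"
  shows "decidable m (\<lambda>e. \<exists>i < h e. P i e)"
proof -
  have "(if \<exists>i < n. Q i then 1 else 0) = rec_nat (0::nat) (\<lambda>i r. if Q i then 1 else r) n" for Q n
  proof (induction n)
    case (Suc n)
    have "(\<exists>i < Suc n. Q i) \<longleftrightarrow> Q n \<or> (\<exists>i < n. Q i)" by (auto simp: less_Suc_eq)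
    then show ?case using Suc by (simp del: One_nat_def)
  qed simp
  then show ?thesis unfolding decidable_def
    by (simp only:) (intro computable_intros assms(2), rule assms(1), simp_all)
qed

lemma computable_sum [computable_intros]:
  assumes "computable (Suc (Suc m)) (\<lambda>e. f (e 0) (\<lambda>i. e (Suc (Suc i))))" "computable m h"
  shows "computable m (\<lambda>e. \<Sum>i < h e. f i e)"
proof -
  have rec: "sum f {..<n} = rec_nat (0::nat) (\<lambda>i r. r + f i) n" for f n by (induction n) auto
  show ?thesis unfolding rec by (intro computable_intros assms) simp_all
qed

lemma computable_mod [computable_intros]:
  assumes "computable m f" "computable m g"
  shows "computable m (\<lambda>e. f e mod g e)"
proof -
  \<comment> \<open>For \<open>b = 0\<close> the reset never happens and the value is
    \<open>a\<close>, in accordance with \<open>a mod 0 = a\<close>.\<close>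
  have rec: "a mod b = rec_nat 0 (\<lambda>_ r. if Suc r = b then 0 else Suc r) a" for a b :: nat
    by (induction a) (auto simp: mod_Suc)
  show ?thesis unfolding rec by (intro computable_intros computable_shift assms) simp_all
qed

lemma computable_div [computable_intros]:
  assumes "computable m f" "computable m g"
  shows "computable m (\<lambda>e. f e div g e)"
proof -
  \<comment> \<open>For \<open>b = 0\<close> the remainder \<open>Suc i mod b\<close> is never 0, so
    the count stays at \<open>a div 0 = 0\<close>.\<close>
  have rec: "a div b = rec_nat 0 (\<lambda>i r. if Suc i mod b = 0 then Suc r else r) a" for a b :: nat
    by (induction a) (auto simp: div_Suc)
  show ?thesis unfolding rec by (intro computable_intros computable_shift assms) simp_all
qed

text \<open>The index of the antidiagonal of \<open>\<nat> \<times> \<nat>\<close> on which \<^const>\<open>prod_decode\<close> finds \<open>n\<close>.\<close>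

definition triangle_root :: "nat \<Rightarrow> nat" where
  "triangle_root n = rec_nat 0 (\<lambda>i r. if Suc i = triangle (Suc r) then Suc r else r) n"

lemma triangle_root_bounds: "triangle (triangle_root n) \<le> n \<and> n < triangle (Suc (triangle_root n))"
  by (induction n) (auto simp: triangle_root_def)

lemma triangle_mono: "i \<le> j \<Longrightarrow> triangle i \<le> triangle j"
  by (induction rule: dec_induct) auto

text \<open>The code of \<open>(a, b)\<close> is \<open>triangle (a + b) + a\<close>, which lies
  between consecutive triangular numbers, so \<open>triangle_root\<close> recovers
  \<open>a + b\<close>.\<close>

lemma prod_decode_conv:
  "prod_decode n = (n - triangle (triangle_root n), triangle_root n - (n - triangle (triangle_root n)))"
proof -
  obtain a b where ab: "prod_decode n = (a, b)" by (cases "prod_decode n")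
  then have n: "n = triangle (a + b) + a"
    using prod_decode_inverse[of n] by (simp add: prod_encode_def)
  have "\<not> triangle_root n < a + b"
    using triangle_root_bounds[of n] triangle_mono[of "Suc (triangle_root n)" "a + b"] n by linarith
  moreover have "\<not> a + b < triangle_root n"
    using triangle_root_bounds[of n] triangle_mono[of "Suc (a + b)" "triangle_root n"] n
      triangle_Suc[of "a + b"] by linarith
  ultimately have "triangle_root n = a + b" by simp
  then show ?thesis using ab n by simp
qed

lemma computable_triangle [computable_intros]:
  assumes "computable m f"
  shows "computable m (\<lambda>e. triangle (f e))"
proof -
  have rec: "triangle n = rec_nat 0 (\<lambda>i r. r + Suc i) n" for n by (induction n) auto
  show ?thesis unfolding rec by (intro computable_intros assms) simp_all
qed

lemma computable_triangle_root [computable_intros]: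
  "computable m f \<Longrightarrow> computable m (\<lambda>e. triangle_root (f e))"
  unfolding triangle_root_def by (intro computable_intros) simp_all

lemma computable_prod_decode [computable_intros]:
  assumes "computable m f"
  shows "computable m (\<lambda>e. fst (prod_decode (f e)))" "computable m (\<lambda>e. snd (prod_decode (f e)))"
  unfolding prod_decode_conv fst_conv snd_conv by (intro computable_intros assms)+

text \<open>The code of a nonempty list is the successor of the code of the pair of its head and its
  coded tail, hence the \<open>c - 1\<close>.\<close>

definition hd_code :: "nat \<Rightarrow> nat" where
  "hd_code c = fst (prod_decode (c - 1))"

definition tl_code :: "nat \<Rightarrow> nat" where
  "tl_code c = snd (prod_decode (c - 1))"

definition nth_code :: "nat \<Rightarrow> nat \<Rightarrow> nat" where
  "nth_code c i = hd_code (rec_nat c (\<lambda>_ r. tl_code r) i)"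

lemma hd_code_Cons [simp]: "hd_code (list_encode (x # xs)) = x"
  by (simp add: hd_code_def)

lemma tl_code_Cons [simp]: "tl_code (list_encode (x # xs)) = list_encode xs"
  by (simp add: tl_code_def)

lemma nth_code_list_encode:
  assumes "i < length xs"
  shows "nth_code (list_encode xs) i = xs ! i"
proof -
  have "rec_nat (list_encode xs) (\<lambda>_ r. tl_code r) i = list_encode (drop i xs)" if "i \<le> length xs" for i
    using that
  proof (induction i)
    case (Suc i)
    then have "drop i xs = xs ! i # drop (Suc i) xs" by (simp add: Cons_nth_drop_Suc)
    then show ?case using Suc by (simp del: list_encode.simps)
  qed simp
  moreover have "drop i xs = xs ! i # drop (Suc i) xs" using assms by (simp add: Cons_nth_drop_Suc)
  ultimately show ?thesis using assms by (simp add: nth_code_def del: list_encode.simps)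
qed

lemma computable_hd_code [computable_intros]: "computable m f \<Longrightarrow> computable m (\<lambda>e. hd_code (f e))"
  unfolding hd_code_def by (intro computable_intros)

lemma computable_tl_code [computable_intros]: "computable m f \<Longrightarrow> computable m (\<lambda>e. tl_code (f e))"
  unfolding tl_code_def by (intro computable_intros)

lemma computable_nth_code [computable_intros]:
  "computable m f \<Longrightarrow> computable m g \<Longrightarrow> computable m (\<lambda>e. nth_code (f e) (g e))"
  unfolding nth_code_def by (intro computable_intros) simp_all

section \<open>The decision procedure\<close>

definition digit :: "nat \<Rightarrow> nat \<Rightarrow> nat \<Rightarrow> nat" where
  "digit k z i = z div k ^ i mod k"

text \<open>The first letter is the least significant digit. The length is not part of the code and
  is passed separately.\<close>

definition word_code :: "nat \<Rightarrow> nat list \<Rightarrow> nat" where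
  "word_code k x = (\<Sum>i < length x. x ! i * k ^ i)"

lemma sum_digits_less: "(\<And>i. i < m \<Longrightarrow> f i < k) \<Longrightarrow> (\<Sum>i < m. f i * k ^ i) < (k::nat) ^ m"
proof (induction m)
  case (Suc m)
  then have "Suc (f m) * k ^ m \<le> k * k ^ m" by (intro mult_le_mono1) (simp add: Suc_leI)
  moreover have "(\<Sum>i < m. f i * k ^ i) < k ^ m" using Suc by simp
  ultimately show ?case by simp
qed simp

lemma digit_sum:
  assumes "\<And>i. i < m \<Longrightarrow> f i < k" "j < m"
  shows "digit k (\<Sum>i < m. f i * k ^ i) j = f j"
  using assms
proof (induction m)
  case (Suc m)
  have k: "0 < k" using Suc.prems(1)[of m] by simp
  show ?case
  proof (cases "j = m")
    case True
    have "(\<Sum>i < m. f i * k ^ i) < k ^ m" using Suc.prems by (intro sum_digits_less) simp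
    then show ?thesis using True k Suc.prems(1)[of m] by (simp add: digit_def)
  next
    case False
    then have j: "j < m" using Suc.prems by simp
    \<comment> \<open>The added term is a multiple of \<open>k ^ Suc j\<close>, so digit
      \<open>j\<close> does not see it.\<close>
    then have "k ^ m = k ^ j * (k * k ^ (m - Suc j))"
      by (metis Suc_diff_Suc add_diff_inverse_nat less_imp_le_nat not_less power_Suc power_add)
    then have "(\<Sum>i < Suc m. f i * k ^ i) = (\<Sum>i < m. f i * k ^ i) + k ^ j * (k * (f m * k ^ (m - Suc j)))"
      by simp
    then have "digit k (\<Sum>i < Suc m. f i * k ^ i) j = digit k (\<Sum>i < m. f i * k ^ i) j"
      using k by (simp only: digit_def) simp
    then show ?thesis using Suc j by simp
  qed
qed simp

lemma digit_word_code: "set x \<subseteq> {0..<k} \<Longrightarrow> i < length x \<Longrightarrow> digit k (word_code k x) i = x ! i"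
  unfolding word_code_def by (intro digit_sum) (auto dest!: nth_mem)

text \<open>The state of the recursion is the code of the unread part of \<open>u\<close> or of the current copy of \<open>v\<close>.\<close>

definition letter_code :: "nat \<Rightarrow> nat \<Rightarrow> nat \<Rightarrow> nat" where
  "letter_code u v i =
     hd_code (rec_nat (if u = 0 then v else u) (\<lambda>_ r. if tl_code r = 0 then v else tl_code r) i)"

definition prefix_code :: "nat \<Rightarrow> nat \<Rightarrow> nat \<Rightarrow> nat \<Rightarrow> nat" where
  "prefix_code k u v m = (\<Sum>i < m. letter_code u v i * k ^ i)"

definition section_code :: "nat \<Rightarrow> nat \<Rightarrow> nat \<Rightarrow> nat \<Rightarrow> nat" where
  "section_code T k s x = snd (prod_decode (nth_code T (s * k + x)))"

definition output_code :: "nat \<Rightarrow> nat \<Rightarrow> nat \<Rightarrow> nat \<Rightarrow> nat" where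
  "output_code T k s x = fst (prod_decode (nth_code T (s * k + x)))"

definition state_code :: "nat \<Rightarrow> nat \<Rightarrow> nat \<Rightarrow> nat \<Rightarrow> nat \<Rightarrow> nat" where
  "state_code T k s z i = rec_nat s (\<lambda>i q. section_code T k q (digit k z i)) i"

definition apply_code :: "nat \<Rightarrow> nat \<Rightarrow> nat \<Rightarrow> nat \<Rightarrow> nat \<Rightarrow> nat" where
  "apply_code T k m s z = (\<Sum>i < m. output_code T k (state_code T k s z i) (digit k z i) * k ^ i)"

definition run_code :: "nat \<Rightarrow> nat \<Rightarrow> nat \<Rightarrow> nat \<Rightarrow> nat \<Rightarrow> nat \<Rightarrow> nat \<Rightarrow> nat" where
  "run_code T k n m c z j = rec_nat z (\<lambda>i z. apply_code T k m (digit n c i) z) j"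

definition agree_code :: "nat \<Rightarrow> nat \<Rightarrow> nat \<Rightarrow> nat \<Rightarrow> bool" where
  "agree_code k m y z \<longleftrightarrow> \<not> (\<exists>i < m. digit k y i \<noteq> digit k z i)"

text \<open>
  The base-\<open>n\<close> digits of \<open>c\<close> are the states applied successively to the word coded by \<open>z\<close>.
\<close>

definition branching_test :: "nat \<Rightarrow> nat \<Rightarrow> nat \<Rightarrow> nat \<Rightarrow> nat \<Rightarrow> bool" where
  "branching_test k n T N z \<longleftrightarrow>
     (\<exists>c < n ^ (k ^ (2 * N) * k ^ (2 * N)). \<exists>j < Suc (k ^ (2 * N) * k ^ (2 * N)).
        agree_code k N (run_code T k n (2 * N) c z j) z \<and>
        \<not> agree_code k (2 * N) (run_code T k n (2 * N) c z j) z)"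

text \<open>Here \<open>u\<close> and \<open>v\<close> are codes of words, which bound the lengths of the words from above.\<close>

definition level_bound :: "nat \<Rightarrow> nat \<Rightarrow> nat \<Rightarrow> nat \<Rightarrow> nat" where
  "level_bound k n u v = u + v * info_bound k n"

section \<open>Computability of the test\<close>

lemma computable_digit [computable_intros]:
  "computable m f \<Longrightarrow> computable m g \<Longrightarrow> computable m h \<Longrightarrow> computable m (\<lambda>e. digit (f e) (g e) (h e))"
  unfolding digit_def by (intro computable_intros)

lemma computable_letter_code [computable_intros]:
  "computable m f \<Longrightarrow> computable m g \<Longrightarrow> computable m h \<Longrightarrow> computable m (\<lambda>e. letter_code (f e) (g e) (h e))"
  unfolding letter_code_def by (intro computable_intros computable_shift) simp_all

lemma computable_prefix_code [computable_intros]: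
  "computable m f \<Longrightarrow> computable m g \<Longrightarrow> computable m h \<Longrightarrow> computable m h' \<Longrightarrow>
    computable m (\<lambda>e. prefix_code (f e) (g e) (h e) (h' e))"
  unfolding prefix_code_def by (intro computable_intros computable_shift) simp_all

lemma computable_section_code [computable_intros]:
  "computable m f \<Longrightarrow> computable m g \<Longrightarrow> computable m h \<Longrightarrow> computable m h' \<Longrightarrow>
    computable m (\<lambda>e. section_code (f e) (g e) (h e) (h' e))"
  unfolding section_code_def by (intro computable_intros)

lemma computable_output_code [computable_intros]:
  "computable m f \<Longrightarrow> computable m g \<Longrightarrow> computable m h \<Longrightarrow> computable m h' \<Longrightarrow>
    computable m (\<lambda>e. output_code (f e) (g e) (h e) (h' e))"
  unfolding output_code_def by (intro computable_intros)

lemma computable_state_code [computable_intros]: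
  "computable m f \<Longrightarrow> computable m g \<Longrightarrow> computable m h \<Longrightarrow> computable m h' \<Longrightarrow> computable m h'' \<Longrightarrow>
    computable m (\<lambda>e. state_code (f e) (g e) (h e) (h' e) (h'' e))"
  unfolding state_code_def by (intro computable_intros computable_shift) simp_all

lemma computable_apply_code [computable_intros]:
  "computable m f \<Longrightarrow> computable m g \<Longrightarrow> computable m h \<Longrightarrow> computable m h' \<Longrightarrow> computable m h'' \<Longrightarrow>
    computable m (\<lambda>e. apply_code (f e) (g e) (h e) (h' e) (h'' e))"
  unfolding apply_code_def by (intro computable_intros computable_shift) simp_all

lemma computable_run_code [computable_intros]:
  "computable m T \<Longrightarrow> computable m f \<Longrightarrow> computable m g \<Longrightarrow> computable m h \<Longrightarrow> computable m h' \<Longrightarrow> computable m h'' \<Longrightarrow>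
    computable m j \<Longrightarrow> computable m (\<lambda>e. run_code (T e) (f e) (g e) (h e) (h' e) (h'' e) (j e))"
  unfolding run_code_def by (intro computable_intros computable_shift) simp_all

lemma decidable_agree_code [computable_intros]:
  "computable m f \<Longrightarrow> computable m g \<Longrightarrow> computable m h \<Longrightarrow> computable m h' \<Longrightarrow>
    decidable m (\<lambda>e. agree_code (f e) (g e) (h e) (h' e))"
  unfolding agree_code_def by (intro computable_intros computable_shift) simp_all

lemma decidable_branching_test [computable_intros]:
  "computable m f \<Longrightarrow> computable m g \<Longrightarrow> computable m h \<Longrightarrow> computable m h' \<Longrightarrow> computable m h'' \<Longrightarrow>
    decidable m (\<lambda>e. branching_test (f e) (g e) (h e) (h' e) (h'' e))"
  unfolding branching_test_def by (intro computable_intros computable_shift) simp_all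

lemma computable_level_bound [computable_intros]:
  "computable m f \<Longrightarrow> computable m g \<Longrightarrow> computable m h \<Longrightarrow> computable m h' \<Longrightarrow>
    computable m (\<lambda>e. level_bound (f e) (g e) (h e) (h' e))"
  unfolding level_bound_def info_bound_def active_bound_def Let_def by (intro computable_intros)

section \<open>Correctness of the coding\<close>

lemma length_le_list_encode: "length xs \<le> list_encode xs"
proof (induction xs)
  case (Cons x xs)
  then show ?case using le_prod_encode_2[of "list_encode xs" x] by simp
qed simp

lemma list_encode_eq_0_iff [simp]: "list_encode xs = 0 \<longleftrightarrow> xs = []"
  by (cases xs) auto

text \<open>Invariant: after \<open>i\<close> steps the state codes a nonempty word which, continued
  by \<open>iter v\<close>, is the rest of the sequence from position \<open>i\<close>. Nonemptiness
  makes the head the required letter.\<close>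

lemma letter_code_correct:
  assumes v: "v \<noteq> []"
  shows "letter_code (list_encode u) (list_encode v) i = (u \<frown> iter v) i"
proof -
  let ?r = "\<lambda>i. rec_nat (if list_encode u = 0 then list_encode v else list_encode u)
    (\<lambda>_ r. if tl_code r = 0 then list_encode v else tl_code r) i"
  have iter: "v \<frown> iter v = iter v" using v iter_unroll[of v] by simp
  obtain y ys where vy: "v = y # ys" using v by (cases v) auto
  have "\<exists>x xs. ?r i = list_encode (x # xs) \<and> suffix i (u \<frown> iter v) = (x # xs) \<frown> iter v"
  proof (induction i)
    case 0
    show ?case
    proof (cases u)
      case Nil
      have "?r 0 = list_encode v" by (simp add: Nil)
      moreover have "suffix 0 (u \<frown> iter v) = v \<frown> iter v" by (simp add: Nil iter)
      ultimately show ?thesis using vy by metis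
    next
      case (Cons y ys)
      then show ?thesis by (intro exI[of _ y] exI[of _ ys]) simp
    qed
  next
    case (Suc i)
    then obtain x xs where xs: "?r i = list_encode (x # xs)" "suffix i (u \<frown> iter v) = (x # xs) \<frown> iter v"
      by blast
    have "suffix (Suc i) (u \<frown> iter v) = suffix 1 (suffix i (u \<frown> iter v))" by simp
    also have "\<dots> = xs \<frown> iter v" unfolding xs(2) by (simp add: fun_eq_iff conc_def)
    finally have suf: "suffix (Suc i) (u \<frown> iter v) = xs \<frown> iter v" .
    have r: "?r (Suc i) = (if xs = [] then list_encode v else list_encode xs)"
      using xs(1) by (simp del: list_encode.simps)
    show ?case
    proof (cases xs)
      case Nil
      have "?r (Suc i) = list_encode v" using r by (simp only: Nil if_True refl)
      moreover have "suffix (Suc i) (u \<frown> iter v) = v \<frown> iter v" unfolding suf by (simp add: Nil iter)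
      ultimately show ?thesis using vy by metis
    qed (use r suf in auto)
  qed
  then obtain x xs where x: "?r i = list_encode (x # xs)" "suffix i (u \<frown> iter v) = (x # xs) \<frown> iter v"
    by blast
  have "(u \<frown> iter v) i = suffix i (u \<frown> iter v) 0" by simp
  also have "\<dots> = x" by (simp only: x(2)) simp
  finally show ?thesis using x(1) unfolding letter_code_def by (simp del: list_encode.simps)
qed

lemma state_output_nth:
  "i < length x \<Longrightarrow> state_output A s x ! i = fst (trans A (state_section A s (take i x), x ! i))"
proof (induction x arbitrary: s i)
  case (Cons a x)
  then show ?case by (cases i) auto
qed simp

locale numbered_automaton =
  fixes A :: "(nat, nat) automaton" and k n T :: nat
  assumes fin: "finite_automaton A" and alphabet: "alphabet A = {0..<k}" and states: "states A = {0..<n}"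
    and T: "T = transition_table_code A k n"
begin

lemma words_iff: "x \<in> words A \<longleftrightarrow> set x \<subseteq> {0..<k}"
  by (auto simp: alphabet in_lists_conv_set)

lemma nth_code_table:
  assumes "s < n" "x < k"
  shows "nth_code T (s * k + x) = prod_encode (trans A (s, x))"
proof -
  have "s * k + x < n * k"
  proof -
    have "s * k + x < Suc s * k" using assms by simp
    also have "\<dots> \<le> n * k" using assms by (intro mult_le_mono1) simp
    finally show ?thesis .
  qed
  then show ?thesis
    using assms by (simp add: T transition_table_code_def nth_code_list_encode List.product_nth)
qed

lemma code_step:
  "s < n \<Longrightarrow> x < k \<Longrightarrow> section_code T k s x = snd (trans A (s, x))"
  "s < n \<Longrightarrow> x < k \<Longrightarrow> output_code T k s x = fst (trans A (s, x))"
  by (simp_all add: section_code_def output_code_def nth_code_table)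

lemma state_code_correct:
  assumes "s < n" "x \<in> words A" "i \<le> length x"
  shows "state_code T k s (word_code k x) i = state_section A s (take i x)"
  using assms(3)
proof (induction i)
  case (Suc i)
  then have i: "i < length x" by simp
  have "take i x \<in> words A" using assms(2) by (auto simp: words_iff dest: in_set_takeD)
  then have "state_section A s (take i x) < n"
    using state_section_in_states[OF fin, of s "take i x"] assms(1) by (simp add: states)
  moreover have "x ! i < k" using assms(2) i by (auto simp: words_iff dest!: nth_mem)
  ultimately have "section_code T k (state_section A s (take i x)) (x ! i)
      = snd (trans A (state_section A s (take i x), x ! i))"
    by (rule code_step)
  moreover have "digit k (word_code k x) i = x ! i"
    using assms(2) i by (intro digit_word_code) (simp_all add: words_iff)
  ultimately show ?case using Suc i
    by (simp add: state_code_def take_Suc_conv_app_nth state_section_append)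
qed (simp add: state_code_def)

lemma apply_code_correct:
  assumes "s < n" "x \<in> words A"
  shows "apply_code T k (length x) s (word_code k x) = word_code k (state_output A s x)"
  unfolding apply_code_def word_code_def[of k "state_output A s x"] length_state_output
proof (rule sum.cong)
  fix i assume "i \<in> {..<length x}"
  then have i: "i < length x" by simp
  have "take i x \<in> words A" using assms(2) by (auto simp: words_iff dest: in_set_takeD)
  then have "state_section A s (take i x) < n"
    using state_section_in_states[OF fin, of s "take i x"] assms(1) by (simp add: states)
  moreover have "x ! i < k" using assms(2) i by (auto simp: words_iff dest!: nth_mem)
  moreover have "digit k (word_code k x) i = x ! i"
    using assms(2) i by (intro digit_word_code) (simp_all add: words_iff)
  ultimately show "output_code T k (state_code T k s (word_code k x) i) (digit k (word_code k x) i) * k ^ i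
      = state_output A s x ! i * k ^ i"
    using i assms by (simp add: state_code_correct code_step state_output_nth)
qed simp

definition run :: "(nat \<Rightarrow> nat) \<Rightarrow> nat list \<Rightarrow> nat \<Rightarrow> nat list" where
  "run f x j = rec_nat x (\<lambda>i y. state_output A (f i) y) j"

lemma run_simps [simp]: "run f x 0 = x" "run f x (Suc j) = state_output A (f j) (run f x j)"
  by (simp_all add: run_def)

lemma run_cong: "(\<And>i. i < j \<Longrightarrow> f i = g i) \<Longrightarrow> run f x j = run g x j"
  by (induction j) auto

lemma length_run [simp]: "length (run f x j) = length x"
  by (induction j) auto

lemma run_in_words:
  "x \<in> words A \<Longrightarrow> (\<And>i. i < j \<Longrightarrow> f i < n) \<Longrightarrow> run f x j \<in> words A"
proof (induction j)
  case (Suc j)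
  then show ?case using state_output_in_words[OF fin, of "f j" "run f x j"] by (simp add: states)
qed simp

lemma run_code_correct:
  assumes "x \<in> words A" "\<And>i. i < j \<Longrightarrow> digit n c i < n"
  shows "run_code T k n (length x) c (word_code k x) j = word_code k (run (digit n c) x j)"
  using assms(2)
proof (induction j)
  case (Suc j)
  then show ?case
    using apply_code_correct[of "digit n c j" "run (digit n c) x j"] run_in_words[OF assms(1), of j "digit n c"]
    by (simp add: run_code_def)
qed (simp add: run_code_def)

text \<open>Turns reachability into a bounded search: a path can be chosen no longer than the number
  of edges between words of the given length, hence no longer than the number of pairs of such
  words.\<close>

lemma full_rel_iff_run:
  assumes x: "x \<in> words A"
  shows "(x, z) \<in> (full_rel A)\<^sup>* \<longleftrightarrow>
    (\<exists>j \<le> k ^ length x * k ^ length x. \<exists>f. (\<forall>i < j. f i < n) \<and> z = run f x j)"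
proof
  let ?W = "{v \<in> words A. length v = length x}"
  \<comment> \<open>Restricting to one length makes the relation finite, so that its cardinality
    bounds the number of steps.\<close>
  let ?R = "full_rel A \<inter> ?W \<times> ?W"
  have fa: "finite (alphabet A)" "card (alphabet A) = k" by (simp_all add: alphabet)
  have fW: "finite ?W" by (rule finite_words_length[OF fa(1)])
  then have "finite ?R" by blast
  have "card ?R \<le> card (?W \<times> ?W)" using fW by (intro card_mono) auto
  then have card: "card ?R \<le> k ^ length x * k ^ length x"
    by (simp only: card_cartesian_product card_words_length[OF fa(1)] fa(2))
  assume "(x, z) \<in> (full_rel A)\<^sup>*"
  then have "(x, z) \<in> ?R\<^sup>* \<and> z \<in> ?W"
  proof (induction rule: rtrancl_induct)
    case (step y z)
    then have "z \<in> ?W"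
      using state_output_in_words[OF fin] unfolding full_rel_iff by fastforce
    then have "(y, z) \<in> ?R" using step by blast
    then show ?case using step.IH \<open>z \<in> ?W\<close> by (meson rtrancl.rtrancl_into_rtrancl)
  qed (use x in simp)
  then obtain j where j: "j \<le> card ?R" "(x, z) \<in> ?R ^^ j"
    unfolding rtrancl_finite_eq_relpow[OF \<open>finite ?R\<close>] by blast
  have "\<exists>f. (\<forall>i < j. f i < n) \<and> z = run f x j"
    using j(2)
  proof (induction j arbitrary: z)
    case (Suc j)
    then obtain y where y: "(x, y) \<in> ?R ^^ j" "(y, z) \<in> full_rel A" by auto
    from Suc.IH[OF y(1)] obtain f where f: "\<forall>i < j. f i < n" "y = run f x j" by blast
    obtain s where s: "s < n" "z = state_output A s y" using y(2) by (auto simp: full_rel_iff states)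
    have "run (f(j := s)) x j = run f x j" by (rule run_cong) simp
    then have "z = run (f(j := s)) x (Suc j)" using f s by (simp only: run_simps fun_upd_same)
    moreover have "\<forall>i < Suc j. (f(j := s)) i < n" using f s by (simp add: less_Suc_eq)
    ultimately show ?case by blast
  qed simp
  then show "\<exists>j \<le> k ^ length x * k ^ length x. \<exists>f. (\<forall>i < j. f i < n) \<and> z = run f x j"
    using j(1) card le_trans by blast
next
  assume "\<exists>j \<le> k ^ length x * k ^ length x. \<exists>f. (\<forall>i < j. f i < n) \<and> z = run f x j"
  then obtain j f where f: "\<forall>i < j. f i < n" and z: "z = run f x j" by blast
  show "(x, z) \<in> (full_rel A)\<^sup>*"
    unfolding z using f
  proof (induction j)
    case (Suc j)
    then have "(run f x j, run f x (Suc j)) \<in> full_rel A"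
      using run_in_words[OF x, of j f] by (auto simp: full_rel_iff states)
    then show ?case using Suc by (meson less_SucI rtrancl.rtrancl_into_rtrancl)
  qed simp
qed

lemma agree_code_correct:
  assumes "x \<in> words A" "y \<in> words A" "length x = length y" "m \<le> length x"
  shows "agree_code k m (word_code k x) (word_code k y) \<longleftrightarrow> take m x = take m y"
proof -
  have "digit k (word_code k x) i = x ! i" "digit k (word_code k y) i = y ! i" if "i < m" for i
    using that assms by (auto intro!: digit_word_code simp: words_iff)
  then show ?thesis using assms(3,4) by (auto simp: agree_code_def list_eq_iff_nth_eq)
qed

lemma branching_test_correct:
  assumes x: "x \<in> words A" "length x = 2 * N"
  shows "branching_test k n T N (word_code k x) \<longleftrightarrow>
    (\<exists>z. (x, z) \<in> (full_rel A)\<^sup>* \<and> take N z = take N x \<and> z \<noteq> x)"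
proof -
  let ?R = "k ^ (2 * N) * k ^ (2 * N)"
  have agree: "agree_code k N (word_code k z) (word_code k x) \<longleftrightarrow> take N z = take N x"
    "agree_code k (2 * N) (word_code k z) (word_code k x) \<longleftrightarrow> z = x" if "z \<in> words A" "length z = 2 * N" for z
    using agree_code_correct[of z x N] agree_code_correct[of z x "2 * N"] that x by auto
  show ?thesis
  proof
    assume "branching_test k n T N (word_code k x)"
    then obtain c j where c: "c < n ^ ?R" and j: "j < Suc ?R"
      and t: "agree_code k N (run_code T k n (2 * N) c (word_code k x) j) (word_code k x)"
        "\<not> agree_code k (2 * N) (run_code T k n (2 * N) c (word_code k x) j) (word_code k x)"
      unfolding branching_test_def by blast
    \<comment> \<open>Zero steps leave the word unchanged, against the second test. So the exponent
      \<open>?R\<close> is positive and \<open>c < n ^ ?R\<close> forces \<open>0 < n\<close>, which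
      makes all base-\<open>n\<close> digits of \<open>c\<close> valid states.\<close>
    have "j \<noteq> 0"
    proof
      assume "j = 0"
      then have "run_code T k n (2 * N) c (word_code k x) j = word_code k x" by (simp add: run_code_def)
      then show False using t(2) by (simp add: agree_code_def)
    qed
    then have "0 < n" using c j by (cases "n = 0") (auto simp: power_0_left split: if_splits)
    then have dig: "digit n c i < n" for i by (simp add: digit_def)
    define z where "z = run (digit n c) x j"
    have z: "z \<in> words A" "length z = 2 * N" using run_in_words x dig by (auto simp: z_def)
    have "run_code T k n (2 * N) c (word_code k x) j = word_code k z"
      using run_code_correct[OF x(1) dig, of j] x(2) by (simp add: z_def)
    then have "take N z = take N x" "z \<noteq> x" using t agree z by auto
    moreover have "(x, z) \<in> (full_rel A)\<^sup>*"
      unfolding full_rel_iff_run[OF x(1)] x(2) z_def using j dig by (intro exI[of _ j] conjI exI[of _ "digit n c"]) auto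
    ultimately show "\<exists>z. (x, z) \<in> (full_rel A)\<^sup>* \<and> take N z = take N x \<and> z \<noteq> x" by blast
  next
    assume "\<exists>z. (x, z) \<in> (full_rel A)\<^sup>* \<and> take N z = take N x \<and> z \<noteq> x"
    then obtain z where z: "(x, z) \<in> (full_rel A)\<^sup>*" "take N z = take N x" "z \<noteq> x" by blast
    then obtain j f where j: "j \<le> ?R" and f: "\<And>i. i < j \<Longrightarrow> f i < n" and zf: "z = run f x j"
      unfolding full_rel_iff_run[OF x(1)] x(2) by blast
    have "j \<noteq> 0" using z(3) zf by (cases j) auto
    then have "0 < n" using f[of 0] by simp
    \<comment> \<open>The states along the path become the first \<open>j\<close> digits of
      \<open>c\<close>.\<close>
    define c where "c = (\<Sum>i < j. f i * n ^ i)"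
    have dig: "digit n c i = f i" if "i < j" for i unfolding c_def using f that by (rule digit_sum)
    have "c < n ^ j" unfolding c_def using f by (rule sum_digits_less)
    also have "\<dots> \<le> n ^ ?R" using j \<open>0 < n\<close> by (intro power_increasing) auto
    finally have c: "c < n ^ ?R" .
    have "run (digit n c) x j = z" unfolding zf using dig by (rule run_cong)
    then have run: "run_code T k n (2 * N) c (word_code k x) j = word_code k z"
      using run_code_correct[OF x(1), of j c] dig f x(2) by simp
    have "z \<in> words A" "length z = 2 * N" using run_in_words[OF x(1), of j f] f x(2) by (auto simp: zf simp del: in_lists_conv_set)
    then show "branching_test k n T N (word_code k x)"
      unfolding branching_test_def using c j agree[of z] z
      by (intro exI[of _ c] exI[of _ j] conjI) (simp_all only: run less_Suc_eq_le, simp_all)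
  qed
qed

end

theorem corollary1p3:
  shows "\<exists>p. \<forall>k n (A :: (nat, nat) automaton) u v.
    alphabet A = {0..<k} \<longrightarrow> states A = {0..<n} \<longrightarrow> bounded_automaton A \<longrightarrow>
    u \<in> words A \<longrightarrow> v \<in> words A \<longrightarrow> v \<noteq> [] \<longrightarrow>
    evals p (input_code k n A u v)
      (if finite (orbit (automaton_group A) omega_action (u \<frown> iter v)) then 1 else 0)"
proof -
  let ?N = "\<lambda>k n u v. level_bound k n u v"
  let ?test = "\<lambda>k n T u v. branching_test k n T (?N k n u v) (prefix_code k u v (2 * ?N k n u v))"
  \<comment> \<open>The variables follow the order of \<open>input_code\<close>. On valid input the
    test succeeds iff the orbit is infinite, hence the order of the answers 0 and 1; all searches
    are bounded, so the program halts on every tuple of five numbers.\<close>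
  have "computable 5 (\<lambda>e. if ?test (e 0) (e 1) (e 2) (e 3) (e 4) then 0 else 1)"
    by (intro computable_intros) simp_all
  then obtain p where p: "\<And>xs. length xs = 5 \<Longrightarrow>
      evals p xs (if ?test (xs ! 0) (xs ! 1) (xs ! 2) (xs ! 3) (xs ! 4) then 0 else 1)"
    unfolding computable_def by blast
  show ?thesis
  proof (intro exI[of _ p] allI impI)
    fix k n :: nat and A :: "(nat, nat) automaton" and u v
    assume alphabet: "alphabet A = {0..<k}" and states: "states A = {0..<n}" and A: "bounded_automaton A"
      and u: "u \<in> words A" and v: "v \<in> words A" "v \<noteq> []"
    define w where "w = u \<frown> iter v"
    define T where "T = transition_table_code A k n"
    define N where "N = level_bound k n (list_encode u) (list_encode v)"
    have fin: "finite_automaton A" using A by (simp add: bounded_automaton_def)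
    interpret numbered_automaton A k n T by unfold_locales (simp_all add: fin alphabet states T_def)
    have rw: "range w \<subseteq> alphabet A"
    proof -
      have "w i \<in> alphabet A" for i
      proof (cases "i < length u")
        case True
        then show ?thesis using u by (auto simp: w_def in_lists_conv_set)
      next
        case False
        then show ?thesis using v by (auto simp: w_def in_lists_conv_set)
      qed
      then show ?thesis by blast
    qed
    interpret word_automaton A w using fin rw by unfold_locales
    have per: "w (i + length v) = w i" if "length u \<le> i" for i
      using that v(2) by (simp add: w_def) (simp add: le_mod_geq)
    \<comment> \<open>The sequence has preperiod \<open>length u\<close> and period
      \<open>length v\<close>; \<open>N\<close> is computed from the codes, which are at least these
      lengths.\<close>
    have "length u + length v * info_bound (card (alphabet A)) (card (states A)) \<le> N"
      unfolding N_def level_bound_def alphabet states card_atLeastLessThan diff_zero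
      by (intro add_mono mult_le_mono1 length_le_list_encode)
    from finite_orbit_iff_bounded[OF A rw _ per this] v(2)
    have orbit: "finite (orbit (automaton_group A) omega_action w) \<longleftrightarrow> \<not> (\<exists>z. (prefix (2 * N) w, z) \<in> (full_rel A)\<^sup>* \<and>
        take N z = prefix N w \<and> z \<noteq> prefix (2 * N) w)"
      by simp
    have "prefix_code k (list_encode u) (list_encode v) (2 * N) = word_code k (prefix (2 * N) w)"
      unfolding prefix_code_def word_code_def by (simp add: letter_code_correct[OF v(2)] w_def)
    moreover have "branching_test k n T N (word_code k (prefix (2 * N) w)) \<longleftrightarrow>
        \<not> finite (orbit (automaton_group A) omega_action w)"
    proof -
      have "length (prefix (2 * N) w) = 2 * N" "take N (prefix (2 * N) w) = prefix N w" by simp_all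
      then show ?thesis by (simp only: branching_test_correct[OF prefix_in_words] orbit not_not)
    qed
    ultimately show "evals p (input_code k n A u v)
        (if finite (orbit (automaton_group A) omega_action (u \<frown> iter v)) then 1 else 0)"
      using p[of "input_code k n A u v"]
      by (cases "finite (orbit (automaton_group A) omega_action w)")
        (simp_all add: input_code_def T_def[symmetric] N_def[symmetric] w_def[symmetric])
  qed
qed

end
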